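(* Let $G$ be a group with an ascending normal series whose factors are locally soluble. Then the set of all Engel elements of $G$ coincides with the Hirsch-Plotkin radical of $G$.
   Context: Commutators in a group are $[x,y]=x^{-1}y^{-1}xy$, and $[x,_0 y]=x$, $[x,_n y]=[[x,_{n-1}y],y]$ for $n\ge 1$. An element $x$ of a group $G$ is called a (left) Engel element of $G$ if for every $g\in G$ there exists $n=n(x,g)\ge 1$ such that $[g,_n x]=1$. An ascending normal series of $G$ is a family $(G_\alpha)_{\alpha\le\beta}$ of normal subgroups of $G$ indexed by the ordinals $\alpha\le\beta$ (for some ordinal $\beta$), with $G_0=1$, $G_\beta=G$, $G_\alpha\le G_{\alpha+1}$ for all $\alpha<\beta$, and $G_\lambda=\bigcup_{\alpha<\lambda}G_\alpha$ for limit ordinals $\lambda\le\beta$; its factors are the quotients $G_{\alpha+1}/G_\alpha$. A group is locally soluble (respectively locally nilpotent) if each of its finitely generated subgroups is soluble (respectively nilpotent). The Hirsch-Plotkin radical of $G$ is the unique maximal normal locally nilpotent subgroup of $G$; it contains all normal locally nilpotent subgroups of $G$. *)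

theory Defs
  imports "HOL-Algebra.Algebra"
begin

definition commutator :: "('a, 'b) monoid_scheme \<Rightarrow> 'a \<Rightarrow> 'a \<Rightarrow> 'a" where
  "commutator G x y = inv\<^bsub>G\<^esub> x \<otimes>\<^bsub>G\<^esub> inv\<^bsub>G\<^esub> y \<otimes>\<^bsub>G\<^esub> x \<otimes>\<^bsub>G\<^esub> y"

(* [x,_n y] *)
primrec iterated_commutator :: "('a, 'b) monoid_scheme \<Rightarrow> 'a \<Rightarrow> 'a \<Rightarrow> nat \<Rightarrow> 'a" where
  "iterated_commutator G x y 0 = x"
| "iterated_commutator G x y (Suc n) = commutator G (iterated_commutator G x y n) y"

(* Left Engel elements: the candidate x is the repeated, right-hand entry of [g,_n x]. *)
definition engel_elements :: "('a, 'b) monoid_scheme \<Rightarrow> 'a set" where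
  "engel_elements G =
     {x \<in> carrier G. \<forall>g \<in> carrier G. \<exists>n\<ge>1. iterated_commutator G g x n = \<one>\<^bsub>G\<^esub>}"

primrec lower_central_series :: "('a, 'b) monoid_scheme \<Rightarrow> nat \<Rightarrow> 'a set" where
  "lower_central_series G 0 = carrier G"
| "lower_central_series G (Suc n) =
     generate G {commutator G x y | x y. x \<in> lower_central_series G n \<and> y \<in> carrier G}"

definition nilpotent :: "('a, 'b) monoid_scheme \<Rightarrow> bool" where
  "nilpotent G \<longleftrightarrow> (\<exists>n. lower_central_series G n = {\<one>\<^bsub>G\<^esub>})"

definition locally_nilpotent :: "('a, 'b) monoid_scheme \<Rightarrow> bool" where
  "locally_nilpotent G \<longleftrightarrow>
     (\<forall>S. finite S \<and> S \<subseteq> carrier G \<longrightarrow> nilpotent (G\<lparr>carrier := generate G S\<rparr>))"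

definition locally_solvable :: "('a, 'b) monoid_scheme \<Rightarrow> bool" where
  "locally_solvable G \<longleftrightarrow>
     (\<forall>S. finite S \<and> S \<subseteq> carrier G \<longrightarrow> solvable (G\<lparr>carrier := generate G S\<rparr>))"

definition maximal_normal_locally_nilpotent :: "('a, 'b) monoid_scheme \<Rightarrow> 'a set \<Rightarrow> bool" where
  "maximal_normal_locally_nilpotent G H \<longleftrightarrow>
     H \<lhd> G \<and> locally_nilpotent (G\<lparr>carrier := H\<rparr>) \<and>
     (\<forall>K. K \<lhd> G \<and> locally_nilpotent (G\<lparr>carrier := K\<rparr>) \<and> H \<subseteq> K \<longrightarrow> K = H)"

(* Such an H exists and is unique in every group, by the Hirsch-Plotkin theorem. *)
definition hirsch_plotkin_radical :: "('a, 'b) monoid_scheme \<Rightarrow> 'a set" where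
  "hirsch_plotkin_radical G = (THE H. maximal_normal_locally_nilpotent G H)"

(* Ordinals are elements of an arbitrary well-ordered type 'i: the ordinals \<alpha> \<le> \<beta> are the
   elements of {..\<beta>}, the ordinal 0 is the least element of 'i, and \<alpha> + 1 is the following
   element. The latter is meaningful only if some element of 'i exceeds \<alpha>, as is
   the case wherever it is used below. *)
definition ord_zero :: "'i::wellorder" where
  "ord_zero = (LEAST \<alpha>. True)"

definition ord_succ :: "'i::wellorder \<Rightarrow> 'i" where
  "ord_succ \<alpha> = (LEAST \<gamma>. \<alpha> < \<gamma>)"

definition is_limit :: "'i::wellorder \<Rightarrow> bool" where
  "is_limit \<mu> \<longleftrightarrow> \<mu> \<noteq> ord_zero \<and> (\<forall>\<alpha><\<mu>. \<mu> \<noteq> ord_succ \<alpha>)"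

definition ascending_normal_series ::
    "('a, 'b) monoid_scheme \<Rightarrow> 'i::wellorder \<Rightarrow> ('i \<Rightarrow> 'a set) \<Rightarrow> bool" where
  "ascending_normal_series G \<beta> N \<longleftrightarrow>
     (\<forall>\<alpha>\<le>\<beta>. N \<alpha> \<lhd> G) \<and>
     N ord_zero = {\<one>\<^bsub>G\<^esub>} \<and>
     N \<beta> = carrier G \<and>
     (\<forall>\<alpha><\<beta>. N \<alpha> \<subseteq> N (ord_succ \<alpha>)) \<and>
     (\<forall>\<mu>\<le>\<beta>. is_limit \<mu> \<longrightarrow> N \<mu> = (\<Union>\<alpha>\<in>{..<\<mu>}. N \<alpha>))"

definition series_factor ::
    "('a, 'b) monoid_scheme \<Rightarrow> ('i::wellorder \<Rightarrow> 'a set) \<Rightarrow> 'i \<Rightarrow> 'a set monoid" where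
  "series_factor G N \<alpha> = G\<lparr>carrier := N (ord_succ \<alpha>)\<rparr> Mod N \<alpha>"

end

theory Submission
  imports Defs
begin

text \<open>The core is that finitely many Engel elements of \<open>G\<close> generate a nilpotent subgroup
  (\<open>engel_generated_nilpotent\<close>). Granting this, the subgroup generated by the set \<open>E\<close> of all Engel
  elements is locally nilpotent, and it is normal because conjugates of Engel elements are Engel.
  Conversely, every element \<open>x\<close> of a normal locally nilpotent subgroup \<open>H\<close> is Engel, since
  \<open>[g, x]\<close> and \<open>x\<close> both lie in \<open>H\<close> and so generate a nilpotent group. Hence \<open>E\<close> is itself a
  normal locally nilpotent subgroup and contains all the others, which makes it the radical. In
  particular there is exactly one maximal such subgroup, as the definition of the radical
  presupposes.

  For the core, let \<open>K\<close> be generated by a finite set of Engel elements, and take the least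
  \<open>\<alpha>\<close> such that \<open>K\<close> is nilpotent modulo its intersection with the term \<open>N \<alpha>\<close> of the series.
  It is not a limit: nilpotency modulo a normal subgroup says that finitely many commutators in
  the generators lie in it, so it already holds modulo an earlier term (\<open>nilpotent_mod_limit\<close>).
  If it is a successor of \<open>\<delta>\<close>, the intersection of \<open>K\<close> with \<open>N \<alpha>\<close> is finitely generated
  (\<open>finitely_generated_of_nilpotent_quotient\<close>), hence soluble modulo \<open>N \<delta>\<close>, and an argument of
  Gruenberg's type descends its derived series: each abelian section is finitely generated and \<open>K\<close>
  acts on it nilpotently (\<open>engel_generated_acts_nilpotently\<close>). So \<open>K\<close> is nilpotent modulo
  \<open>N \<delta>\<close>, against minimality. Therefore \<open>\<alpha>\<close> is zero and \<open>K\<close> is nilpotent.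

  Both lemmas on finitely generated groups use induction on the nilpotency class of \<open>H / N\<close>,
  where \<open>H\<close> is generated by \<open>N\<close> and finitely many Engel elements. The subgroup generated by \<open>N\<close>
  and the conjugates of one Engel generator is again generated by \<open>N\<close> and finitely many Engel
  elements, and has smaller class over \<open>N\<close> (\<open>nilpotency_class_drop\<close>) unless \<open>H / N\<close> is abelian.
  The abelian case reduces to a cyclic quotient, where the Engel condition is used directly.

  The inductions take place inside one ambient group, modulo normal subgroups, so that being an Engel
  element always refers to the same group.\<close>
section \<open>Commutator calculus\<close>

context group
begin

abbreviation conjugate :: "'a \<Rightarrow> 'a \<Rightarrow> 'a" where
  "conjugate x h \<equiv> inv h \<otimes> x \<otimes> h"

lemma inv_cancel_left:
  assumes "x \<in> carrier G" "y \<in> carrier G"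
  shows "x \<otimes> (inv x \<otimes> y) = y" "inv x \<otimes> (x \<otimes> y) = y"
  using assms by (simp_all flip: m_assoc)

lemmas group_word_simps = commutator_def inv_mult_group m_assoc inv_cancel_left

lemma commutator_closed [simp]:
  "x \<in> carrier G \<Longrightarrow> y \<in> carrier G \<Longrightarrow> commutator G x y \<in> carrier G"
  by (simp add: commutator_def)

lemma
  assumes "x \<in> carrier G" "y \<in> carrier G" "z \<in> carrier G"
  shows commutator_mult_left:
      "commutator G (x \<otimes> y) z = conjugate (commutator G x z) y \<otimes> commutator G y z"
    and commutator_mult_right:
      "commutator G x (y \<otimes> z) = commutator G x z \<otimes> conjugate (commutator G x y) z"
    and conjugate_commutator:
      "conjugate (commutator G x y) z = commutator G (conjugate x z) (conjugate y z)"
    and conjugate_mult: "conjugate (x \<otimes> y) z = conjugate x z \<otimes> conjugate y z"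
    and conjugate_conjugate: "conjugate (conjugate x y) z = conjugate x (y \<otimes> z)"
  using assms by (simp_all add: group_word_simps)

lemma
  assumes "x \<in> carrier G" "y \<in> carrier G"
  shows commutator_inv_right:
      "commutator G x (inv y) = conjugate (inv (commutator G x y)) (inv y)"
    and inv_commutator: "inv (commutator G x y) = commutator G y x"
    and conjugate_eq_mult_commutator: "conjugate x y = x \<otimes> commutator G x y"
    and commutator_eq_mult_conjugate: "commutator G x y = inv x \<otimes> conjugate x y"
    and conjugate_inv: "inv (conjugate x y) = conjugate (inv x) y"
    and conjugate_inv_cancel: "conjugate (conjugate x (inv y)) y = x"
  using assms by (simp_all add: group_word_simps)

lemma commutator_one [simp]:
  assumes "x \<in> carrier G"
  shows "commutator G x x = \<one>" "commutator G x \<one> = \<one>" "commutator G \<one> x = \<one>"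
  using assms by (simp_all add: group_word_simps)

text \<open>Normality relative to a subgroup \<open>H\<close>, stated with conjugation by elements of \<open>H\<close> in the
  ambient group: in the inductions below \<open>H\<close> varies while the ambient group stays the same.\<close>
definition normal_in :: "'a set \<Rightarrow> 'a set \<Rightarrow> bool" where
  "normal_in N H \<longleftrightarrow>
     subgroup N G \<and> subgroup H G \<and> N \<subseteq> H \<and> (\<forall>h\<in>H. \<forall>x\<in>N. conjugate x h \<in> N)"

lemma subgroup_conjugate_closed:
  assumes "subgroup H G" "x \<in> H" "y \<in> H"
  shows "conjugate x y \<in> H"
  using assms by (simp add: subgroup.m_closed subgroup.m_inv_closed)

lemma subgroup_commutator_closed:
  assumes "subgroup H G" "x \<in> H" "y \<in> H"
  shows "commutator G x y \<in> H"
  using assms by (simp add: commutator_def subgroup.m_closed subgroup.m_inv_closed)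

lemma normal_inD:
  assumes "normal_in N H"
  shows "subgroup N G" "subgroup H G" "N \<subseteq> H" "\<And>x h. x \<in> N \<Longrightarrow> h \<in> H \<Longrightarrow> conjugate x h \<in> N"
  using assms by (auto simp: normal_in_def)

lemma normal_in_refl: "subgroup H G \<Longrightarrow> normal_in H H"
  by (simp add: normal_in_def subgroup_conjugate_closed)

lemma normal_in_subgroup:
  assumes "normal_in N H" "subgroup K G" "K \<subseteq> H" "N \<subseteq> K"
  shows "normal_in N K"
  using assms unfolding normal_in_def by blast

lemma normal_in_Int_subgroup:
  assumes "normal_in N H" "subgroup K G" "K \<subseteq> H"
  shows "normal_in (N \<inter> K) K"
  using assms unfolding normal_in_def
  by (auto intro: subgroups_Inter_pair subgroup_conjugate_closed)

lemma normal_in_commutator_closed: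
  assumes "normal_in N H" "x \<in> N" "h \<in> H"
  shows "commutator G x h \<in> N" "commutator G h x \<in> N"
proof -
  have c: "x \<in> carrier G" "h \<in> carrier G"
    using assms normal_inD subgroup.mem_carrier by metis+
  show "commutator G x h \<in> N"
    using assms normal_inD[OF assms(1)]
    by (simp add: commutator_eq_mult_conjugate c subgroup.m_closed subgroup.m_inv_closed)
  then show "commutator G h x \<in> N"
    using normal_inD(1)[OF assms(1)] inv_commutator[OF c] subgroup.m_inv_closed by fastforce
qed

lemma normal_iff_normal_in: "N \<lhd> G \<longleftrightarrow> normal_in N (carrier G)"
proof
  assume N: "N \<lhd> G"
  then have "subgroup N G" "\<forall>x\<in>carrier G. \<forall>h\<in>N. x \<otimes> h \<otimes> inv x \<in> N"
    using normal_inv_iff by auto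
  then show "normal_in N (carrier G)"
    unfolding normal_in_def
    by (metis group.inv_inv inv_closed is_group subgroup.subset subgroup_self)
next
  assume N: "normal_in N (carrier G)"
  show "N \<lhd> G"
  proof (rule normal_invI[OF normal_inD(1)[OF N]])
    fix x h assume "x \<in> carrier G" "h \<in> N"
    then show "x \<otimes> h \<otimes> inv x \<in> N"
      using normal_inD(4)[OF N, of h "inv x"] by simp
  qed
qed

lemma generate_induct_subgroup:
  assumes "subgroup K G" "S \<subseteq> K" "x \<in> generate G S"
  shows "x \<in> K"
  using assms generate_subgroup_incl by blast

lemma normal_in_generate:
  assumes H: "subgroup H G" and "S \<subseteq> H" and conj: "\<And>s h. s \<in> S \<Longrightarrow> h \<in> H \<Longrightarrow> conjugate s h \<in> generate G S"
  shows "normal_in (generate G S) H"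
proof -
  have S: "S \<subseteq> carrier G" using assms subgroup.subset by blast
  have sub: "subgroup (generate G S) G" by (rule generate_is_subgroup[OF S])
  have "conjugate x h \<in> generate G S" if "x \<in> generate G S" "h \<in> H" for x h
    using that(1)
  proof induction
    case one
    then show ?case using H that sub by (simp add: subgroup.mem_carrier subgroup.one_closed)
  next
    case (incl s)
    then show ?case using conj that by blast
  next
    case (inv s)
    have "conjugate (inv s) h = inv (conjugate s h)"
      using inv S that H by (simp add: conjugate_inv subgroup.mem_carrier subset_iff)
    then show ?case using conj[OF inv that(2)] sub subgroup.m_inv_closed by metis
  next
    case (eng a b)
    have "conjugate (a \<otimes> b) h = conjugate a h \<otimes> conjugate b h"
      using eng S that H by (simp add: conjugate_mult generate_in_carrier subgroup.mem_carrier)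
    then show ?case using eng generate.eng by metis
  qed
  then show ?thesis
    using assms sub generate_subgroup_incl by (auto simp: normal_in_def)
qed

lemma generate_finite_support:
  assumes "x \<in> generate G S"
  shows "\<exists>T. finite T \<and> T \<subseteq> S \<and> x \<in> generate G T"
  using assms
proof induction
  case one
  then show ?case using generate.one by blast
next
  case (incl h)
  then show ?case by (intro exI[of _ "{h}"]) (auto intro: generate.incl)
next
  case (inv h)
  then show ?case by (intro exI[of _ "{h}"]) (auto intro: generate.inv)
next
  case (eng a b)
  then obtain T U where "finite T" "T \<subseteq> S" "a \<in> generate G T" "finite U" "U \<subseteq> S" "b \<in> generate G U"
    by blast
  then show ?case
    using mono_generate[of T "T \<union> U"] mono_generate[of U "T \<union> U"]
    by (intro exI[of _ "T \<union> U"]) (auto intro: generate.eng)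
qed

lemma generate_finite_support_set:
  assumes "finite F" "F \<subseteq> generate G S"
  shows "\<exists>T. finite T \<and> T \<subseteq> S \<and> F \<subseteq> generate G T"
  using assms
proof (induction rule: finite_induct)
  case empty
  then show ?case by blast
next
  case (insert x F)
  obtain T where T: "finite T" "T \<subseteq> S" "F \<subseteq> generate G T"
    using insert.IH insert.prems by auto
  obtain U where U: "finite U" "U \<subseteq> S" "x \<in> generate G U"
    using insert.prems generate_finite_support[of x S] by auto
  have "insert x F \<subseteq> generate G (T \<union> U)"
    using T(3) U(3) mono_generate[of T "T \<union> U"] mono_generate[of U "T \<union> U"] by auto
  moreover have "finite (T \<union> U)" "T \<union> U \<subseteq> S"
    using T U by auto
  ultimately show ?case by meson
qed

definition finitely_generated :: "'a set \<Rightarrow> bool" where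
  "finitely_generated H \<longleftrightarrow> (\<exists>F. finite F \<and> F \<subseteq> carrier G \<and> H = generate G F)"

text \<open>By compactness, a finitely generated group needs only finitely many elements of any
  generating set, here applied to the part of the set that lies outside \<open>A\<close>.\<close>
lemma finitely_generated_over:
  assumes "finitely_generated (generate G (A \<union> Y))" and "A \<union> Y \<subseteq> carrier G"
  shows "\<exists>T. finite T \<and> T \<subseteq> Y \<and> generate G (A \<union> Y) = generate G (A \<union> T)"
proof -
  obtain F where F: "finite F" "F \<subseteq> carrier G" "generate G (A \<union> Y) = generate G F"
    using assms by (auto simp: finitely_generated_def)
  then have "F \<subseteq> generate G (A \<union> Y)" by (auto intro: generate.incl)
  then obtain U where U: "finite U" "U \<subseteq> A \<union> Y" "F \<subseteq> generate G U"
    using generate_finite_support_set F by meson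
  have "F \<subseteq> generate G (A \<union> (U \<inter> Y))"
    using U mono_generate[of U "A \<union> (U \<inter> Y)"] by blast
  then have "generate G F \<subseteq> generate G (A \<union> (U \<inter> Y))"
    using assms(2) by (intro generate_subgroup_incl generate_is_subgroup) auto
  moreover have "generate G (A \<union> (U \<inter> Y)) \<subseteq> generate G (A \<union> Y)"
    by (intro mono_generate) auto
  ultimately have "generate G (A \<union> Y) = generate G (A \<union> (U \<inter> Y))"
    unfolding F(3) by (rule equalityI)
  moreover have "finite (U \<inter> Y)" "U \<inter> Y \<subseteq> Y"
    using U(1) by auto
  ultimately show ?thesis
    by meson
qed

text \<open>By the product formulas for commutators, centralizing \<open>a\<close> modulo \<open>C\<close> may be tested on
  generators.\<close>
lemma centralizer_mod_subgroup:
  assumes "normal_in C H" "a \<in> H"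
  shows "subgroup {z \<in> H. commutator G a z \<in> C} G" "subgroup {z \<in> H. commutator G z a \<in> C} G"
proof -
  note N = normal_inD[OF assms(1)]
  have H: "x \<in> carrier G" if "x \<in> H" for x using that subgroup.mem_carrier[OF N(2)] by simp
  have "commutator G a z \<in> C \<longleftrightarrow> commutator G z a \<in> C" if "z \<in> H" for z
    using inv_commutator[of a z] inv_commutator[of z a] H[OF that] H[OF assms(2)]
      subgroup.m_inv_closed[OF N(1), of "commutator G a z"]
      subgroup.m_inv_closed[OF N(1), of "commutator G z a"]
    by auto
  then have eq: "{z \<in> H. commutator G z a \<in> C} = {z \<in> H. commutator G a z \<in> C}" by blast
  show sub: "subgroup {z \<in> H. commutator G a z \<in> C} G"
  proof (rule subgroupI)
    show "{z \<in> H. commutator G a z \<in> C} \<subseteq> carrier G" using H by blast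
    show "{z \<in> H. commutator G a z \<in> C} \<noteq> {}"
      using N(1,2) H assms subgroup.one_closed commutator_one(2) by fastforce
  next
    fix z assume z: "z \<in> {z \<in> H. commutator G a z \<in> C}"
    then have "conjugate (inv (commutator G a z)) (inv z) \<in> C"
      using N(1,2) by (intro N(4)) (auto intro: subgroup.m_inv_closed)
    then show "inv z \<in> {z \<in> H. commutator G a z \<in> C}"
      using z H assms N(2) by (simp add: commutator_inv_right subgroup.m_inv_closed)
  next
    fix z w assume "z \<in> {z \<in> H. commutator G a z \<in> C}" "w \<in> {z \<in> H. commutator G a z \<in> C}"
    then show "z \<otimes> w \<in> {z \<in> H. commutator G a z \<in> C}"
      using H assms N by (simp add: commutator_mult_right subgroup.m_closed)
  qed
  then show "subgroup {z \<in> H. commutator G z a \<in> C} G" by (simp add: eq)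
qed

text \<open>The centralizer argument, applied first in one entry of the commutator and then in the
  other.\<close>
lemma commutator_generate_generate:
  assumes C: "normal_in C H" and "S \<subseteq> H" "T \<subseteq> H"
    and "\<And>s t. s \<in> S \<Longrightarrow> t \<in> T \<Longrightarrow> commutator G s t \<in> C"
    and "x \<in> generate G S" "y \<in> generate G T"
  shows "commutator G x y \<in> C"
proof -
  have H: "subgroup H G" using normal_inD C by blast
  have "commutator G s y \<in> C" if "s \<in> S" for s
    using generate_induct_subgroup[OF centralizer_mod_subgroup(1)[OF C, of s], of T y] assms that
    by blast
  moreover have "y \<in> H" using generate_induct_subgroup H assms by blast
  ultimately show ?thesis
    using generate_induct_subgroup[OF centralizer_mod_subgroup(2)[OF C, of y], of S x] assms
    by blast
qed

section \<open>Relative upper central series\<close>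

text \<open>The elements of \<open>T\<close> that enter \<open>B\<close> after commutation with any \<open>n\<close> elements of \<open>Z\<close>. With
  \<open>T = Z = H\<close> it is the preimage of the \<open>n\<close>-th upper central term of \<open>H / B\<close>, so
  \<open>H \<subseteq> upper_central H B H n\<close> says that \<open>H / B\<close> is nilpotent of class at most \<open>n\<close>. Likewise,
  \<open>A \<subseteq> upper_central A B Z n\<close> says that \<open>Z\<close> acts nilpotently on \<open>A / B\<close>.\<close>
primrec upper_central :: "'a set \<Rightarrow> 'a set \<Rightarrow> 'a set \<Rightarrow> nat \<Rightarrow> 'a set" where
  "upper_central T B Z 0 = B"
| "upper_central T B Z (Suc n) = {a \<in> T. \<forall>z\<in>Z. commutator G a z \<in> upper_central T B Z n}"

lemma upper_central_antimono:
  assumes "Z \<subseteq> Z'"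
  shows "upper_central T B Z' n \<subseteq> upper_central T B Z n"
  using assms by (induction n) auto

lemma upper_central_mono:
  assumes "B \<subseteq> B'"
  shows "upper_central T B Z n \<subseteq> upper_central T B' Z n"
  using assms by (induction n) auto

lemma upper_central_mono_total:
  assumes "T \<subseteq> T'"
  shows "upper_central T B Z n \<subseteq> upper_central T' B Z n"
  using assms by (induction n) auto

lemma upper_central_add:
  "upper_central T B Z (m + n) = upper_central T (upper_central T B Z n) Z m"
  by (induction m) auto

lemma normal_in_upper_central:
  assumes T: "normal_in T H" and B: "normal_in B H" "B \<subseteq> T"
    and Z: "Z \<subseteq> H" "\<And>z h. z \<in> Z \<Longrightarrow> h \<in> H \<Longrightarrow> conjugate z h \<in> Z"
  shows "normal_in (upper_central T B Z n) H"
proof (induction n)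
  case 0
  then show ?case using B by simp
next
  case (Suc n)
  let ?U = "upper_central T B Z n"
  note NT = normal_inD[OF T] and N = normal_inD[OF Suc]
  have H: "x \<in> carrier G" if "x \<in> H" for x using that subgroup.mem_carrier[OF N(2)] by simp
  have eq: "upper_central T B Z (Suc n) = T \<inter> (\<Inter>z\<in>Z. {a \<in> H. commutator G a z \<in> ?U})"
    using NT by auto
  have "subgroup (upper_central T B Z (Suc n)) G"
  proof (cases "Z = {}")
    case True
    then show ?thesis using NT by simp
  next
    case False
    have "subgroup (\<Inter>z\<in>Z. {a \<in> H. commutator G a z \<in> ?U}) G"
      using False centralizer_mod_subgroup[OF Suc] Z by (intro subgroups_Inter) auto
    then show ?thesis
      unfolding eq using NT by (intro subgroups_Inter_pair) auto
  qed
  moreover have "conjugate a h \<in> upper_central T B Z (Suc n)"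
    if "a \<in> upper_central T B Z (Suc n)" "h \<in> H" for a h
  proof -
    have a: "a \<in> T" "a \<in> H" using that NT by auto
    have "commutator G (conjugate a h) z \<in> ?U" if z: "z \<in> Z" for z
    proof -
      have "inv h \<in> H" using \<open>h \<in> H\<close> N subgroup.m_inv_closed by metis
      then have z': "conjugate z (inv h) \<in> Z" using Z z by blast
      then have "commutator G a (conjugate z (inv h)) \<in> ?U"
        using \<open>a \<in> upper_central T B Z (Suc n)\<close> by auto
      then have "conjugate (commutator G a (conjugate z (inv h))) h \<in> ?U"
        using \<open>h \<in> H\<close> by (rule N(4))
      moreover have "conjugate (commutator G a (conjugate z (inv h))) h = commutator G (conjugate a h) z"
      proof -
        have c: "z \<in> carrier G" "h \<in> carrier G" "a \<in> carrier G"
          using z Z a \<open>h \<in> H\<close> H by auto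
        then have "conjugate (commutator G a (conjugate z (inv h))) h =
            commutator G (conjugate a h) (conjugate (conjugate z (inv h)) h)"
          by (intro conjugate_commutator) auto
        then show ?thesis using conjugate_inv_cancel[OF c(1,2)] by simp
      qed
      ultimately show ?thesis by simp
    qed
    then show ?thesis using NT(4)[OF a(1) that(2)] by simp
  qed
  ultimately show ?case
    using NT unfolding normal_in_def eq by blast
qed

lemma upper_central_Suc_mono:
  assumes "normal_in B H" "B \<subseteq> T" "Z \<subseteq> H"
  shows "upper_central T B Z n \<subseteq> upper_central T B Z (Suc n)"
proof (induction n)
  case 0
  then show ?case using assms normal_in_commutator_closed(1)[OF assms(1)] by auto
next
  case (Suc n)
  then show ?case by auto
qed

lemma upper_central_le_mono:
  assumes "normal_in B H" "B \<subseteq> T" "Z \<subseteq> H" "m \<le> n"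
  shows "upper_central T B Z m \<subseteq> upper_central T B Z n"
  using assms(4) by (rule lift_Suc_mono_le[of "upper_central T B Z", OF upper_central_Suc_mono[OF assms(1-3)]])

text \<open>Nilpotent action may be tested on generators of the acting group. For the limit step this
  reduces nilpotency of a finitely generated group to finitely many commutators.\<close>
lemma upper_central_generate:
  assumes T: "normal_in T (generate G Z)" and B: "normal_in B (generate G Z)" "B \<subseteq> T"
    and Z: "Z \<subseteq> carrier G"
  shows "upper_central T B (generate G Z) n = upper_central T B Z n"
proof (induction n)
  case 0
  then show ?case by simp
next
  case (Suc n)
  have H: "subgroup (generate G Z) G" using Z by (rule generate_is_subgroup)
  have N: "normal_in (upper_central T B (generate G Z) n) (generate G Z)"
    using T B H by (intro normal_in_upper_central) (auto intro: subgroup_conjugate_closed)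
  have "commutator G a z \<in> upper_central T B (generate G Z) n"
    if "a \<in> upper_central T B Z (Suc n)" "z \<in> generate G Z" for a z
  proof -
    have a: "a \<in> generate G Z" using that normal_inD[OF T] by auto
    show ?thesis
      using generate_induct_subgroup[OF centralizer_mod_subgroup(1)[OF N a], of Z z] that Suc
      by (auto intro: generate.incl)
  qed
  moreover have "upper_central T B (generate G Z) (Suc n) \<subseteq> upper_central T B Z (Suc n)"
    by (intro upper_central_antimono) (auto intro: generate.incl)
  ultimately show ?case by auto
qed

text \<open>A version of Fitting's theorem: if \<open>Y\<close> and \<open>Z\<close> act nilpotently on \<open>A / B\<close>, so does their
  union. Between two consecutive terms of the series of \<open>Y\<close> one inserts the terms of the series
  of \<open>Z\<close>, as in the Schreier refinement of two series. In each step of the refined series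
  commutation with \<open>Y\<close> descends a full term of the first series, while commutation with \<open>Z\<close> stays
  in the same term by normality and descends in the second series.\<close>
lemma upper_central_Un:
  assumes A: "normal_in A H" and B: "normal_in B H" "B \<subseteq> A"
    and Y: "Y \<subseteq> H" "\<And>y h. y \<in> Y \<Longrightarrow> h \<in> H \<Longrightarrow> conjugate y h \<in> Y"
    and Z: "Z \<subseteq> H"
    and m: "A \<subseteq> upper_central A B Y m" and n: "A \<subseteq> upper_central A B Z n"
  shows "A \<subseteq> upper_central A B (Y \<union> Z) (m * n)"
proof -
  let ?C = "upper_central A B Y" and ?D = "upper_central A B Z"
    and ?W = "upper_central A B (Y \<union> Z)"
  have W_mono: "?W i \<subseteq> ?W j" if "i \<le> j" for i j
    using upper_central_le_mono[OF B, of "Y \<union> Z"] Y Z that by simp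
  have "?C i \<subseteq> ?W (i * n)" for i
  proof (induction i)
    case 0
    then show ?case by simp
  next
    case (Suc i)
    have C: "normal_in (?C (Suc i)) H"
      using A B Y by (rule normal_in_upper_central)
    \<comment> \<open>The part of the next \<open>Y\<close>-term that \<open>Z\<close> takes into \<open>B\<close> in \<open>j\<close> steps lies at most \<open>j\<close> levels above the current one.\<close>
    have refine: "?C (Suc i) \<inter> ?D j \<subseteq> ?W (i * n + j)" for j
    proof (induction j)
      case 0
      then show ?case using W_mono[of 0 "i * n"] by auto
    next
      case (Suc j)
      show ?case
      proof
        fix a assume a: "a \<in> ?C (Suc i) \<inter> ?D (Suc j)"
        have "commutator G a y \<in> ?W (i * n + j)" if "y \<in> Y" for y
          using a that \<open>?C i \<subseteq> ?W (i * n)\<close> W_mono[of "i * n" "i * n + j"] by auto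
        moreover have "commutator G a z \<in> ?W (i * n + j)" if "z \<in> Z" for z
        proof -
          have "commutator G a z \<in> ?C (Suc i)"
            using normal_in_commutator_closed(1)[OF C, of a z] a that Z by blast
          moreover have "commutator G a z \<in> ?D j"
            using a that by simp
          ultimately show ?thesis using Suc by blast
        qed
        ultimately show "a \<in> ?W (i * n + Suc j)" using a by auto
      qed
    qed
    have "?C (Suc i) \<subseteq> ?D n"
      using n by auto
    then show ?case using refine[of n] by (auto simp: add.commute)
  qed
  then show ?thesis using m by blast
qed

section \<open>Engel elements\<close>

lemma iterated_commutator_closed:
  "g \<in> carrier G \<Longrightarrow> x \<in> carrier G \<Longrightarrow> iterated_commutator G g x n \<in> carrier G"
  by (induction n) auto

lemma conjugate_iterated_commutator:
  assumes "g \<in> carrier G" "x \<in> carrier G" "h \<in> carrier G"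
  shows "conjugate (iterated_commutator G g x n) h =
    iterated_commutator G (conjugate g h) (conjugate x h) n"
proof (induction n)
  case 0
  then show ?case by simp
next
  case (Suc n)
  have "conjugate (iterated_commutator G g x (Suc n)) h =
      commutator G (conjugate (iterated_commutator G g x n) h) (conjugate x h)"
    using assms conjugate_commutator[OF iterated_commutator_closed] by simp
  then show ?case by (simp add: Suc)
qed

lemma engel_conjugate:
  assumes "x \<in> engel_elements G" "h \<in> carrier G"
  shows "conjugate x h \<in> engel_elements G"
proof -
  have x: "x \<in> carrier G" using assms by (simp add: engel_elements_def)
  have "\<exists>n\<ge>1. iterated_commutator G g (conjugate x h) n = \<one>" if g: "g \<in> carrier G" for g
  proof -
    let ?k = "conjugate g (inv h)"
    have "?k \<in> carrier G" using g assms by simp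
    then obtain n where n: "n \<ge> 1" "iterated_commutator G ?k x n = \<one>"
      using assms(1) by (auto simp: engel_elements_def)
    have "iterated_commutator G g (conjugate x h) n =
        conjugate (iterated_commutator G ?k x n) h"
      using conjugate_iterated_commutator[OF \<open>?k \<in> carrier G\<close> x assms(2)]
        conjugate_inv_cancel[OF g assms(2)] by simp
    also have "\<dots> = \<one>" using n(2) assms(2) by simp
    finally show ?thesis using n(1) by blast
  qed
  then show ?thesis using x assms(2) by (simp add: engel_elements_def)
qed

section \<open>Finite generation of kernels\<close>

text \<open>Division with remainder by the least positive exponent that occurs in \<open>D\<close>, if there is one.\<close>
lemma subgroup_of_cyclic:
  assumes D: "subgroup D G" and x: "x \<in> carrier G" and "D \<subseteq> generate G {x}"
  shows "\<exists>d\<in>D. D = generate G {d}"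
proof -
  have pow: "\<exists>j::int. d = x [^] j" if "d \<in> D" for d
    using that assms(3) generate_pow[OF x] by auto
  define P where "P m \<longleftrightarrow> m > 0 \<and> x [^] int m \<in> D" for m
  show ?thesis
  proof (cases "\<exists>m. P m")
    case True
    define m where "m = (LEAST m. P m)"
    have m: "m > 0" "x [^] int m \<in> D"
      using LeastI_ex[OF True] by (auto simp: m_def P_def)
    have "d \<in> generate G {x [^] int m}" if d: "d \<in> D" for d
    proof -
      obtain j :: int where j: "d = x [^] j" using pow[OF d] by blast
      define r where "r = nat (j mod int m)"
      have r: "int r = j mod int m" "r < m"
        using m(1) by (auto simp: r_def nat_less_iff)
      have q: "(x [^] int m) [^] (j div int m) = x [^] (int m * (j div int m))"
        using x by (simp add: int_pow_pow)
      have "x [^] int r = x [^] (j - int m * (j div int m))"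
        by (simp add: r(1) minus_mult_div_eq_mod)
      also have "\<dots> = d \<otimes> inv ((x [^] int m) [^] (j div int m))"
        using x j q by (simp add: int_pow_diff)
      finally have "x [^] int r \<in> D"
        using d subgroup_int_pow_closed[OF D m(2)] D
        by (simp add: subgroup.m_closed subgroup.m_inv_closed)
      then have "r = 0"
        using not_less_Least[of r P] r(2) unfolding m_def P_def by auto
      then have "j = int m * (j div int m)"
        using r(1) minus_mult_div_eq_mod[of j "int m"] by simp
      then have "d = (x [^] int m) [^] (j div int m)"
        using j q by simp
      then show ?thesis
        using generate_pow[of "x [^] int m"] x by auto
    qed
    moreover have "generate G {x [^] int m} \<subseteq> D"
      using m D by (intro generate_subgroup_incl) auto
    ultimately show ?thesis using m(2) by blast
  next
    case False
    have "d = \<one>" if d: "d \<in> D" for d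
    proof -
      obtain j :: int where j: "d = x [^] j" using pow[OF d] by blast
      have "x [^] (- j) \<in> D"
        using d j D x by (simp add: int_pow_neg subgroup.m_inv_closed)
      then have "\<not> j > 0" "\<not> j < 0"
        using False d j unfolding P_def
        by (metis zero_less_imp_eq_int, metis neg_0_less_iff_less zero_less_imp_eq_int)
      then show ?thesis using j by simp
    qed
    then have "D = {\<one>}" using D subgroup.one_closed by blast
    moreover have "generate G {\<one>} = {\<one>}"
      by (rule generate_one)
    ultimately show ?thesis by auto
  qed
qed

text \<open>The condition on \<open>c\<close> includes its inverse: an infinite subgroup can be mapped properly into
  itself by a conjugation, so closure under \<open>c\<close> alone would not define a subgroup.\<close>
lemma subgroup_normalizing:
  assumes R: "subgroup R G"
  shows "subgroup {c \<in> carrier G. \<forall>r\<in>R. conjugate r c \<in> R \<and> conjugate r (inv c) \<in> R} G"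
    (is "subgroup ?C G")
proof (rule subgroupI)
  have Rc: "r \<in> carrier G" if "r \<in> R" for r
    using that subgroup.mem_carrier[OF R] by simp
  show "?C \<subseteq> carrier G" by blast
  have "\<one> \<in> ?C" using Rc by auto
  then show "?C \<noteq> {}" by blast
  show "inv c \<in> ?C" if "c \<in> ?C" for c
    using that by auto
  fix c d assume c: "c \<in> ?C" and d: "d \<in> ?C"
  have "conjugate r (c \<otimes> d) \<in> R" "conjugate r (inv (c \<otimes> d)) \<in> R" if r: "r \<in> R" for r
  proof -
    have "conjugate (conjugate r c) d \<in> R" "conjugate (conjugate r (inv d)) (inv c) \<in> R"
      using c d r by blast+
    moreover have "conjugate (conjugate r c) d = conjugate r (c \<otimes> d)"
      using c d Rc[OF r] by (intro conjugate_conjugate) auto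
    moreover have "conjugate (conjugate r (inv d)) (inv c) = conjugate r (inv d \<otimes> inv c)"
      using c d Rc[OF r] by (intro conjugate_conjugate) auto
    ultimately show "conjugate r (c \<otimes> d) \<in> R" "conjugate r (inv (c \<otimes> d)) \<in> R"
      using c d by (simp_all add: inv_mult_group)
  qed
  then show "c \<otimes> d \<in> ?C" using c d by blast
qed

lemma subgroup_product:
  assumes R: "subgroup R G" and C: "subgroup C G"
    and conj: "\<And>r c. r \<in> R \<Longrightarrow> c \<in> C \<Longrightarrow> conjugate r c \<in> R"
  shows "subgroup {r \<otimes> c | r c. r \<in> R \<and> c \<in> C} G" (is "subgroup ?L G")
proof (rule subgroupI)
  have Rc: "r \<in> carrier G" if "r \<in> R" for r
    using that subgroup.mem_carrier[OF R] by simp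
  have Cc: "c \<in> carrier G" if "c \<in> C" for c
    using that subgroup.mem_carrier[OF C] by simp
  show "?L \<subseteq> carrier G" using Rc Cc by auto
  show "?L \<noteq> {}" using subgroup.one_closed[OF R] subgroup.one_closed[OF C] by blast
  have conj': "conjugate r (inv c) \<in> R" if "r \<in> R" "c \<in> C" for r c
    using conj[OF that(1) subgroup.m_inv_closed[OF C that(2)]] .
  fix y assume "y \<in> ?L"
  then obtain r c where y: "y = r \<otimes> c" "r \<in> R" "c \<in> C" by blast
  have "inv y = conjugate (inv r) c \<otimes> inv c"
    using y Rc Cc by (simp add: group_word_simps)
  then show "inv y \<in> ?L"
    using conj[of "inv r" c] y subgroup.m_inv_closed[OF R] subgroup.m_inv_closed[OF C] by blast
  fix z assume "z \<in> ?L"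
  then obtain s d where z: "z = s \<otimes> d" "s \<in> R" "d \<in> C" by blast
  have "y \<otimes> z = (r \<otimes> conjugate s (inv c)) \<otimes> (c \<otimes> d)"
    using y z Rc Cc by (simp add: group_word_simps)
  then show "y \<otimes> z \<in> ?L"
    using subgroup.m_closed[OF R y(2) conj'[OF z(2) y(3)]] subgroup.m_closed[OF C y(3) z(3)]
    by blast
qed

text \<open>Write \<open>b i\<close> for \<open>[f,_i x]\<close>. Then \<open>b i\<close> conjugated by \<open>x\<close> is the product of \<open>b i\<close> and
  \<open>b (i + 1)\<close>, and the sequence reaches \<open>1\<close> by the Engel condition. Hence finitely many iterated
  commutators generate a subgroup that contains the infinite orbit of \<open>f\<close> under powers of \<open>x\<close>.\<close>
lemma iterated_commutator_orbit_normalized: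
  assumes F: "F \<subseteq> carrier G" and x: "x \<in> carrier G"
    and n: "\<And>f. f \<in> F \<Longrightarrow> iterated_commutator G f x (n f) = \<one>"
    and R: "R = generate G (\<Union>f\<in>F. iterated_commutator G f x ` {..n f})"
    and "r \<in> R" "c \<in> generate G {x}"
  shows "conjugate r c \<in> R"
proof -
  let ?b = "\<lambda>f i. iterated_commutator G f x i"
  let ?P = "\<Union>f\<in>F. ?b f ` {..n f}"
  have P: "?P \<subseteq> carrier G"
    using F x iterated_commutator_closed by auto
  have subR: "subgroup R G" unfolding R using P by (rule generate_is_subgroup)
  have bR: "?b f i \<in> R" if "f \<in> F" "i \<le> n f" for f i
    unfolding R using that by (intro generate.incl) auto
  have bc: "?b f i \<in> carrier G" if "f \<in> F" for f i
    using that F x by (intro iterated_commutator_closed) auto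
  have forward: "conjugate (?b f i) x \<in> R" if "f \<in> F" "i \<le> n f" for f i
  proof (cases "i = n f")
    case True
    then show ?thesis using n[OF that(1)] x subR by (simp add: subgroup.one_closed)
  next
    case False
    have "conjugate (?b f i) x = ?b f i \<otimes> ?b f (Suc i)"
      using conjugate_eq_mult_commutator[OF bc[OF that(1)] x] by simp
    then show ?thesis
      using bR[of f i] bR[of f "Suc i"] that False subR by (simp add: subgroup.m_closed)
  qed
  \<comment> \<open>For \<open>x\<inverse>\<close> the same relation is solved for \<open>b i\<close>, descending from the trivial last term.\<close>
  have backward: "conjugate (?b f i) (inv x) \<in> R" if f: "f \<in> F" and "i \<le> n f" for f i
    using that(2)
  proof (induction i rule: inc_induct)
    case base
    then show ?case using n[OF f] x subR by (simp add: subgroup.one_closed)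
  next
    case (step i)
    have "conjugate (?b f i) (inv x) = ?b f i \<otimes> inv (conjugate (?b f (Suc i)) (inv x))"
      using bc[OF f, of i] x by (simp add: group_word_simps)
    then show ?case
      using bR[of f i] step f subR by (simp add: subgroup.m_closed subgroup.m_inv_closed)
  qed
  have gen: "conjugate r y \<in> R" if y: "y \<in> {x, inv x}" and r: "r \<in> R" for r y
  proof -
    have yc: "y \<in> carrier G" using y x by auto
    have "r \<in> generate G ?P" using r R by simp
    then show ?thesis
    proof induction
      case one
      then show ?case using yc subR by (simp add: subgroup.one_closed)
    next
      case (incl p)
      then show ?case using y forward backward by auto
    next
      case (inv p)
      have "p \<in> carrier G" using inv P by blast
      then have "conjugate (inv p) y = inv (conjugate p y)" using yc by (simp add: conjugate_inv)
      moreover have "conjugate p y \<in> R" using inv y forward backward by auto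
      ultimately show ?case using subgroup.m_inv_closed[OF subR] by simp
    next
      case (eng p q)
      have "p \<in> carrier G" "q \<in> carrier G"
        using eng generate_in_carrier[OF P] by auto
      then show ?case
        using eng yc subR by (simp add: conjugate_mult subgroup.m_closed)
    qed
  qed
  have "x \<in> {c \<in> carrier G. \<forall>r\<in>R. conjugate r c \<in> R \<and> conjugate r (inv c) \<in> R}"
    using x gen[of x] gen[of "inv x"] by blast
  then have "c \<in> {c \<in> carrier G. \<forall>r\<in>R. conjugate r c \<in> R \<and> conjugate r (inv c) \<in> R}"
    using generate_induct_subgroup[OF subgroup_normalizing[OF subR], of "{x}" c] assms by blast
  then show ?thesis using \<open>r \<in> R\<close> by blast
qed

text \<open>Finitely many elements \<open>F\<close> of \<open>N\<close> generate \<open>K\<close> together with \<open>x\<close>. The conjugates of \<open>F\<close> under powers of \<open>x\<close> lie in the finitely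
  generated group of the preceding lemma, so that group times \<open>\<langle>x\<rangle>\<close> is all of \<open>K\<close>; what remains
  of \<open>N\<close> is its cyclic intersection with \<open>\<langle>x\<rangle>\<close>.\<close>
lemma finitely_generated_of_cyclic_quotient:
  assumes N: "normal_in N K" and "finitely_generated K" and K: "K = generate G (N \<union> {x})"
    and x: "x \<in> engel_elements G"
  shows "finitely_generated N"
proof -
  note NK = normal_inD[OF N]
  have xc: "x \<in> carrier G" using x by (simp add: engel_elements_def)
  have Nc: "N \<subseteq> carrier G" using NK(1) subgroup.subset by blast
  have xK: "x \<in> K" unfolding K by (auto intro: generate.incl)
  have K': "K = generate G ({x} \<union> N)" unfolding K by (simp add: Un_commute)
  obtain F where F: "finite F" "F \<subseteq> N" "K = generate G ({x} \<union> F)"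
    using finitely_generated_over[of "{x}" N] assms(2) K' xc Nc by auto
  have "\<forall>f\<in>F. \<exists>n. iterated_commutator G f x n = \<one>"
    using x F(2) Nc unfolding engel_elements_def by blast
  then obtain n where n: "\<And>f. f \<in> F \<Longrightarrow> iterated_commutator G f x (n f) = \<one>"
    by metis
  define P where "P = (\<Union>f\<in>F. iterated_commutator G f x ` {..n f})"
  have "iterated_commutator G f x i \<in> N" if "f \<in> F" for f i
  proof (induction i)
    case 0
    then show ?case using that F by auto
  next
    case (Suc i)
    then show ?case using normal_in_commutator_closed(1)[OF N _ xK] by simp
  qed
  then have PN: "P \<subseteq> N" by (auto simp: P_def)
  have "finite P" using F(1) by (simp add: P_def)
  let ?C = "generate G {x}"
  let ?L = "{r \<otimes> c | r c. r \<in> generate G P \<and> c \<in> ?C}"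
  have Fc: "F \<subseteq> carrier G" using F(2) Nc by blast
  have "conjugate r c \<in> generate G P" if "r \<in> generate G P" "c \<in> ?C" for r c
    using iterated_commutator_orbit_normalized[OF Fc xc n refl, of r c] that
    unfolding P_def by blast
  then have L: "subgroup ?L G"
    using PN Nc xc by (intro subgroup_product generate_is_subgroup) auto
  have "{x} \<union> F \<subseteq> ?L"
  proof -
    have "x = \<one> \<otimes> x" "\<And>f. f \<in> F \<Longrightarrow> f = f \<otimes> \<one>" using xc Fc by auto
    moreover have "f \<in> generate G P" if "f \<in> F" for f
    proof -
      have "f \<in> P" unfolding P_def using that by (auto intro!: bexI[of _ f] image_eqI[of _ _ 0])
      then show ?thesis by (rule generate.incl)
    qed
    moreover have "x \<in> ?C" by (auto intro: generate.incl)
    ultimately show ?thesis using generate.one[of G P] generate.one[of G "{x}"] by blast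
  qed
  then have KL: "K \<subseteq> ?L" unfolding F(3) using L by (intro generate_subgroup_incl)
  have "subgroup (N \<inter> ?C) G"
    using NK(1) xc by (intro subgroups_Inter_pair generate_is_subgroup) auto
  then obtain d where d: "d \<in> N \<inter> ?C" "N \<inter> ?C = generate G {d}"
    using subgroup_of_cyclic[OF _ xc] by blast
  have "N \<subseteq> generate G (P \<union> {d})"
  proof
    fix y assume y: "y \<in> N"
    then obtain r c where rc: "y = r \<otimes> c" "r \<in> generate G P" "c \<in> ?C"
      using NK(3) KL by blast
    have rN: "r \<in> N" using generate_induct_subgroup[OF NK(1) PN rc(2)] .
    have "c = inv r \<otimes> y"
      using rc rN Nc xc generate_in_carrier[of "{x}" c] by (auto simp: inv_cancel_left)
    then have "c \<in> N \<inter> ?C"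
      using rN y rc(3) NK(1) by (simp add: subgroup.m_closed subgroup.m_inv_closed)
    then have "c \<in> generate G (P \<union> {d})"
      using d(2) mono_generate[of "{d}" "P \<union> {d}"] by blast
    moreover have "r \<in> generate G (P \<union> {d})"
      using rc(2) mono_generate[of P "P \<union> {d}"] by blast
    ultimately show "y \<in> generate G (P \<union> {d})" unfolding rc(1) by (rule generate.eng[rotated])
  qed
  moreover have "generate G (P \<union> {d}) \<subseteq> N"
    using PN d(1) NK(1) by (intro generate_subgroup_incl) auto
  ultimately have "N = generate G (P \<union> {d})" by (rule equalityI)
  then show ?thesis
    unfolding finitely_generated_def using \<open>finite P\<close> PN Nc d(1)
    by (intro exI[of _ "P \<union> {d}"]) auto
qed

section \<open>Soluble groups generated by Engel elements\<close>

abbreviation conjugacy_class :: "'a \<Rightarrow> 'a set \<Rightarrow> 'a set" where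
  "conjugacy_class x H \<equiv> (\<lambda>h. conjugate x h) ` H"

lemma conjugacy_class_closed:
  assumes H: "subgroup H G" and x: "x \<in> H"
  shows "conjugacy_class x H \<subseteq> H" "x \<in> conjugacy_class x H"
    "\<And>y h. y \<in> conjugacy_class x H \<Longrightarrow> h \<in> H \<Longrightarrow> conjugate y h \<in> conjugacy_class x H"
proof -
  have Hc: "h \<in> carrier G" if "h \<in> H" for h using that subgroup.mem_carrier[OF H] by simp
  show "conjugacy_class x H \<subseteq> H" using subgroup_conjugate_closed[OF H x] by auto
  show "x \<in> conjugacy_class x H"
    using Hc[OF x] subgroup.one_closed[OF H] by (intro image_eqI[of _ _ \<one>]) auto
  fix y h assume "y \<in> conjugacy_class x H" and h: "h \<in> H"
  then obtain k where k: "k \<in> H" "y = conjugate x k" by blast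
  have "conjugate y h = conjugate x (k \<otimes> h)"
    unfolding k(2) using Hc x k h by (intro conjugate_conjugate) auto
  then show "conjugate y h \<in> conjugacy_class x H"
    using subgroup.m_closed[OF H k(1) h] by blast
qed

lemma normal_in_generate_conjugacy_class:
  assumes N: "normal_in N H" and x: "x \<in> H"
  shows "normal_in (generate G (N \<union> conjugacy_class x H)) H"
proof (rule normal_in_generate)
  note NH = normal_inD[OF N]
  show "subgroup H G" by (rule NH)
  show "N \<union> conjugacy_class x H \<subseteq> H"
    using NH(3) conjugacy_class_closed(1)[OF NH(2) x] by blast
  fix s h assume s: "s \<in> N \<union> conjugacy_class x H" and h: "h \<in> H"
  then have "conjugate s h \<in> N \<union> conjugacy_class x H"
    using NH(4)[OF _ h] conjugacy_class_closed(3)[OF NH(2) x _ h] by blast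
  then show "conjugate s h \<in> generate G (N \<union> conjugacy_class x H)" by (rule generate.incl)
qed

lemma upper_central_restrict:
  assumes L: "subgroup L G" "L \<subseteq> H"
  shows "upper_central H B H i \<inter> L \<subseteq> upper_central L (B \<inter> L) L i"
proof (induction i)
  case 0
  then show ?case by simp
next
  case (Suc i)
  have "commutator G a z \<in> upper_central H B H i \<inter> L"
    if "a \<in> upper_central H B H (Suc i) \<inter> L" "z \<in> L" for a z
    using that L subgroup_commutator_closed[OF L(1), of a z] by auto
  then show ?case using Suc by auto
qed

text \<open>A conjugate of \<open>x\<close> is \<open>x\<close> times a commutator \<open>[x, h]\<close>, which lies in the term \<open>k + 1\<close> of the
  upper central series. So modulo the term \<open>k\<close> the conjugates of \<open>x\<close> differ by central
  factors and commute: the commutators of \<open>K\<close> lie in that term, and \<open>K\<close> has class at most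
  \<open>k + 1\<close> over \<open>N\<close>.\<close>
lemma nilpotency_class_drop:
  assumes N: "normal_in N H" and H: "H \<subseteq> upper_central H N H (Suc (Suc k))" and x: "x \<in> H"
    and K: "K = generate G (N \<union> conjugacy_class x H)"
  shows "K \<subseteq> upper_central K N K (Suc k)"
proof -
  note NH = normal_inD[OF N]
  let ?U = "upper_central H N H"
  have Hc: "h \<in> carrier G" if "h \<in> H" for h using that subgroup.mem_carrier[OF NH(2)] by simp
  have nK: "normal_in K H" unfolding K using N x by (rule normal_in_generate_conjugacy_class)
  note NK = normal_inD[OF nK]
  have U: "normal_in (?U i) H" for i
    using normal_in_refl[OF NH(2)] N NH subgroup_conjugate_closed[OF NH(2)]
    by (intro normal_in_upper_central) auto
  note NU = normal_inD[OF U]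
  have central: "commutator G u h \<in> ?U k" "commutator G h u \<in> ?U k"
    if "u \<in> ?U (Suc k)" "h \<in> H" for u h
  proof -
    have u: "u \<in> H" using that by auto
    show "commutator G u h \<in> ?U k" using that by simp
    then show "commutator G h u \<in> ?U k"
      using subgroup.m_inv_closed[OF NU(1)] inv_commutator[OF Hc[OF u] Hc[OF that(2)]] by metis
  qed
  have NU1: "N \<subseteq> ?U (Suc k)"
    using upper_central_le_mono[OF N NH(3) subset_refl, of 0 "Suc k"] by simp
  have xh: "commutator G x h \<in> ?U (Suc k)" if "h \<in> H" for h
    using H x that by auto
  have "commutator G a z \<in> ?U k"
    if a: "a \<in> N \<union> conjugacy_class x H" and z: "z \<in> N \<union> conjugacy_class x H" for a z
  proof -
    have aH: "a \<in> H" and zH: "z \<in> H"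
      using a z NH(3) conjugacy_class_closed(1)[OF NH(2) x] by auto
    consider "a \<in> N" | "z \<in> N" | "a \<in> conjugacy_class x H" "z \<in> conjugacy_class x H"
      using a z by blast
    then show ?thesis
    proof cases
      case 1
      then show ?thesis using NU1 central(1) zH by blast
    next
      case 2
      then show ?thesis using NU1 central(2) aH by blast
    next
      case 3
      then obtain g h where g: "g \<in> H" "a = conjugate x g" and h: "h \<in> H" "z = conjugate x h"
        by blast
      let ?u = "commutator G x g" and ?v = "commutator G x h"
      have a': "a = x \<otimes> ?u" and z': "z = x \<otimes> ?v"
        using g h x Hc by (simp_all add: conjugate_eq_mult_commutator)
      have uv: "?u \<in> ?U (Suc k)" "?v \<in> ?U (Suc k)" using xh g h by auto
      have uvH: "?u \<in> H" "?v \<in> H" using subgroup_commutator_closed[OF NH(2)] x g h by auto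
      have "commutator G x z = commutator G x ?v"
        unfolding z' using x uvH Hc commutator_mult_right[of x x ?v] by simp
      then have "conjugate (commutator G x z) ?u \<in> ?U k"
        using NU(4)[OF central(2)[OF uv(2) x] uvH(1)] by simp
      moreover have "commutator G ?u z \<in> ?U k"
        using central(1)[OF uv(1) zH] .
      moreover have "commutator G a z = conjugate (commutator G x z) ?u \<otimes> commutator G ?u z"
        unfolding a' using x uvH zH Hc by (intro commutator_mult_left) auto
      ultimately show ?thesis using subgroup.m_closed[OF NU(1)] by simp
    qed
  qed
  then have comm: "commutator G a z \<in> ?U k" if "a \<in> K" "z \<in> K" for a z
    using commutator_generate_generate[OF U, of "N \<union> conjugacy_class x H"
        "N \<union> conjugacy_class x H" k a z] that NH(3) conjugacy_class_closed(1)[OF NH(2) x]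
    unfolding K by blast
  have "N \<inter> K = N" unfolding K by (auto intro: generate.incl)
  then have restrict: "?U k \<inter> K \<subseteq> upper_central K N K k"
    using upper_central_restrict[OF NK(1,3), of N k] by simp
  have "commutator G a z \<in> upper_central K N K k" if "a \<in> K" "z \<in> K" for a z
    using comm[OF that] subgroup_commutator_closed[OF NK(1) that] restrict by blast
  then show ?thesis by auto
qed

text \<open>The outer induction is on the class, the inner one on the number of Engel generators. For
  one generator \<open>x\<close>, let \<open>K\<close> be generated by \<open>N\<close> and the conjugates of \<open>x\<close>. The quotient \<open>H / K\<close>
  needs one generator less, so \<open>K\<close> is finitely generated by the inner hypothesis; and \<open>K / N\<close> has
  smaller class or is cyclic, which passes finite generation on to \<open>N\<close>.\<close>
lemma finitely_generated_of_nilpotent_quotient: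
  assumes "finitely_generated H" "normal_in N H" "finite S" "S \<subseteq> engel_elements G"
    "H = generate G (N \<union> S)" "H \<subseteq> upper_central H N H c"
  shows "finitely_generated N"
  using assms
proof (induction c arbitrary: H N S)
  case 0
  then have "N = H" using normal_inD(3)[of N H] by auto
  then show ?case using 0 by simp
next
  case (Suc c)
  note fgH = Suc.prems(1)
  show ?case
    using Suc.prems(3,2,4-6)
  proof (induction S arbitrary: N rule: finite_induct)
    case empty
    then have "H = N"
      using generate_subgroup_incl[of N N] normal_inD(1,3)[of N H] by auto
    then show ?case using fgH by simp
  next
    case (insert x S)
    note N = insert.prems(1) and H = insert.prems(3)
    note NH = normal_inD[OF N]
    have Hc: "h \<in> carrier G" if "h \<in> H" for h using that subgroup.mem_carrier[OF NH(2)] by simp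
    have x: "x \<in> H" unfolding H by (rule generate.incl) simp
    have xE: "x \<in> engel_elements G" using insert.prems by auto
    define C where "C = conjugacy_class x H"
    note C = conjugacy_class_closed[OF NH(2) x, folded C_def]
    define K where "K = generate G (N \<union> C)"
    have K: "normal_in K H"
      unfolding K_def C_def using N x by (rule normal_in_generate_conjugacy_class)
    note NK = normal_inD[OF K]
    have NC: "N \<union> C \<subseteq> carrier G" using NH(3) C(1) Hc by blast
    have NCK: "N \<union> C \<subseteq> K" unfolding K_def by (auto intro: generate.incl)
    have "S \<subseteq> H" unfolding H by (auto intro: generate.incl)
    have "H \<subseteq> generate G (K \<union> S)"
      unfolding H using NCK C(2) by (intro mono_generate) auto
    moreover have "generate G (K \<union> S) \<subseteq> H"
      using NK(3) \<open>S \<subseteq> H\<close> NH(2) by (intro generate_subgroup_incl) auto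
    ultimately have "H = generate G (K \<union> S)" by (rule equalityI)
    moreover have "H \<subseteq> upper_central H K H (Suc c)"
      using insert.prems(4) upper_central_mono[of N K H H "Suc c"] NCK by blast
    ultimately have fgK: "finitely_generated K"
      using insert.IH[OF K] insert.prems(2) by auto
    have NK': "normal_in N K"
      using normal_in_subgroup[OF N NK(1) NK(3)] NCK by blast
    show ?case
    proof (cases c)
      case 0
      \<comment> \<open>In an abelian quotient all conjugates of \<open>x\<close> coincide, and \<open>K / N\<close> is cyclic.\<close>
      have "C \<subseteq> generate G (N \<union> {x})"
      proof
        fix y assume "y \<in> C"
        then obtain h where h: "h \<in> H" "y = conjugate x h" unfolding C_def by blast
        have "commutator G x h \<in> N" using insert.prems(4) x h 0 by auto
        moreover have "y = x \<otimes> commutator G x h"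
          using h x Hc by (simp add: conjugate_eq_mult_commutator)
        ultimately show "y \<in> generate G (N \<union> {x})"
          by (simp add: generate.eng generate.incl)
      qed
      moreover have "N \<subseteq> generate G (N \<union> {x})" by (auto intro: generate.incl)
      ultimately have "K \<subseteq> generate G (N \<union> {x})"
        unfolding K_def using NH(3) x Hc
        by (intro generate_subgroup_incl generate_is_subgroup) auto
      moreover have "generate G (N \<union> {x}) \<subseteq> K"
        unfolding K_def using C(2) by (intro mono_generate) auto
      ultimately have "K = generate G (N \<union> {x})" by (rule equalityI)
      then show ?thesis
        using finitely_generated_of_cyclic_quotient[OF NK' fgK _ xE] by simp
    next
      case (Suc k)
      \<comment> \<open>Finite generation of \<open>K\<close> leaves finitely many conjugates, as the outer hypothesis requires.\<close>
      have "\<exists>T. finite T \<and> T \<subseteq> C \<and> K = generate G (N \<union> T)"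
        using finitely_generated_over[of N C] fgK NC unfolding K_def by blast
      then obtain T where T: "finite T" "T \<subseteq> C" "K = generate G (N \<union> T)" by blast
      have "T \<subseteq> engel_elements G"
        using T(2) engel_conjugate[OF xE] Hc unfolding C_def by auto
      moreover have "K \<subseteq> upper_central K N K c"
        unfolding Suc using nilpotency_class_drop[OF N _ x, of k K] insert.prems(4)
        unfolding Suc K_def C_def by blast
      ultimately show ?thesis
        using Suc.IH[OF fgK NK' T(1) _ T(3)] by blast
    qed
  qed
qed

text \<open>By the Fitting argument it suffices that the conjugates of a single Engel generator
  \<open>x\<close>, together with \<open>A\<close>, act nilpotently on the abelian section \<open>A / B\<close>. If \<open>H / A\<close> has class at
  least two, they generate a subgroup of smaller class over \<open>A\<close>, covered by induction. Otherwise
  every conjugate of \<open>x\<close> acts on \<open>A / B\<close> just as \<open>x\<close> does; the Engel condition bounds the number of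
  commutations that kills each generator of \<open>A\<close>, and \<open>A\<close> is finitely generated.\<close>
lemma engel_generated_acts_nilpotently:
  assumes "finitely_generated H" "normal_in A H" "normal_in B H" "B \<subseteq> A"
    "\<And>a b. a \<in> A \<Longrightarrow> b \<in> A \<Longrightarrow> commutator G a b \<in> B"
    "finite S" "S \<subseteq> engel_elements G" "H = generate G (A \<union> S)"
    "H \<subseteq> upper_central H A H c"
  shows "\<exists>m. A \<subseteq> upper_central A B H m"
  using assms
proof (induction c arbitrary: H S)
  case 0
  then have "A = H" using normal_inD(3)[of A H] by auto
  then have "A \<subseteq> upper_central A B H (Suc 0)" using 0(5) by auto
  then show ?case by (rule exI)
next
  case (Suc c)
  note fgH = Suc.prems(1) and A = Suc.prems(2) and B = Suc.prems(3,4) and AB = Suc.prems(5)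
    and S = Suc.prems(6,7) and H = Suc.prems(8) and Hc = Suc.prems(9)
  note NA = normal_inD[OF A] and NB = normal_inD[OF B(1)]
  have Hcarr: "h \<in> carrier G" if "h \<in> H" for h using that subgroup.mem_carrier[OF NA(2)] by simp
  have SH: "S \<subseteq> H" unfolding H by (auto intro: generate.incl)
  have fgA: "finitely_generated A"
    using finitely_generated_of_nilpotent_quotient[OF fgH A S H Hc] .
  have single: "\<exists>m. A \<subseteq> upper_central A B (A \<union> conjugacy_class x H) m" if x: "x \<in> S" for x
  proof -
    have xH: "x \<in> H" and xE: "x \<in> engel_elements G" using x SH S by auto
    define C where "C = conjugacy_class x H"
    note C = conjugacy_class_closed[OF NA(2) xH, folded C_def]
    define K where "K = generate G (A \<union> C)"
    have K: "normal_in K H"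
      unfolding K_def C_def using A xH by (rule normal_in_generate_conjugacy_class)
    note NK = normal_inD[OF K]
    have AC: "A \<union> C \<subseteq> H" using NA(3) C(1) by blast
    have ACK: "A \<union> C \<subseteq> K" unfolding K_def by (auto intro: generate.incl)
    show ?thesis
    proof (cases c)
      case 0
      let ?U = "upper_central A B (A \<union> C)"
      have ACinv: "conjugate y h \<in> A \<union> C" if "y \<in> A \<union> C" "h \<in> H" for y h
        using that NA(4) C(3) by blast
      have U: "normal_in (?U i) H" for i
        using A B AC ACinv by (rule normal_in_upper_central)
      note NU = normal_inD[OF U]
      have BU: "B \<subseteq> ?U i" for i
        using upper_central_le_mono[OF B AC, of 0 i] by simp
      \<comment> \<open>Commutation with \<open>x\<close> alone is enough: \<open>A\<close> centralizes \<open>A / B\<close>, and conjugates lie in \<open>x A\<close>.\<close>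
      have engel: "a \<in> ?U i" if "a \<in> A" "iterated_commutator G a x i \<in> B" for a i
      proof -
        have "iterated_commutator G a x j \<in> A" for j
          using \<open>a \<in> A\<close> normal_in_commutator_closed(1)[OF A _ xH] by (induction j) auto
        then have "iterated_commutator G a x (i - j) \<in> ?U j" if "j \<le> i" for j
          using that
        proof (induction j)
          case 0
          then show ?case using \<open>iterated_commutator G a x i \<in> B\<close> by simp
        next
          case (Suc j)
          let ?b = "iterated_commutator G a x (i - Suc j)"
          have bA: "?b \<in> A" using Suc.prems by blast
          have "Suc (i - Suc j) = i - j" using Suc.prems(2) by simp
          then have bx: "commutator G ?b x \<in> ?U j"
            using Suc.IH[OF Suc.prems(1)] Suc.prems(2) iterated_commutator.simps(2)[of G a x "i - Suc j"]
            by simp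
          have "commutator G ?b z \<in> ?U j" if z: "z \<in> A \<union> C" for z
          proof (cases "z \<in> A")
            case True
            then show ?thesis using AB[OF bA] BU by blast
          next
            case False
            then obtain h where h: "h \<in> H" "z = conjugate x h" using z unfolding C_def by blast
            have u: "commutator G x h \<in> A" using Hc xH h \<open>c = 0\<close> by auto
            have z': "z = x \<otimes> commutator G x h"
              using h xH Hcarr by (simp add: conjugate_eq_mult_commutator)
            have "commutator G ?b z = commutator G ?b (commutator G x h) \<otimes>
                conjugate (commutator G ?b x) (commutator G x h)"
              unfolding z' using bA u xH NA(3) Hcarr by (intro commutator_mult_right) auto
            moreover have "commutator G ?b (commutator G x h) \<in> ?U j"
              using AB[OF bA u] BU by blast
            moreover have "conjugate (commutator G ?b x) (commutator G x h) \<in> ?U j"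
              using NU(4)[OF bx] u NA(3) by blast
            ultimately show ?thesis using subgroup.m_closed[OF NU(1)] by simp
          qed
          then show ?case using bA by simp
        qed
        from this[of i] show ?thesis by simp
      qed
      obtain F where F: "finite F" "F \<subseteq> carrier G" "A = generate G F"
        using fgA unfolding finitely_generated_def by blast
      have "\<exists>i. iterated_commutator G f x i = \<one>" if "f \<in> F" for f
      proof -
        have "f \<in> carrier G" using F(2) that by blast
        then show ?thesis using xE unfolding engel_elements_def by blast
      qed
      then obtain e where e: "\<And>f. f \<in> F \<Longrightarrow> iterated_commutator G f x (e f) = \<one>" by metis
      (* The extra 0 makes the maximum meaningful for an empty set of generators. *)
      define m where "m = Max (insert 0 (e ` F))"
      have "F \<subseteq> ?U m"
      proof
        fix f assume f: "f \<in> F"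
        have "f \<in> A" unfolding F(3) using f by (rule generate.incl)
        then have "f \<in> ?U (e f)" using engel[of f "e f"] e[OF f] subgroup.one_closed[OF NB(1)] by simp
        moreover have "e f \<le> m" unfolding m_def using F(1) f by (intro Max_ge) auto
        ultimately show "f \<in> ?U m" using upper_central_le_mono[OF B AC] by blast
      qed
      then have "A \<subseteq> ?U m" unfolding F(3) using NU(1)[unfolded F(3)] by (intro generate_subgroup_incl)
      then show ?thesis unfolding C_def by blast
    next
      case (Suc k)
      have "H \<subseteq> generate G (K \<union> S)"
        unfolding H using ACK by (intro mono_generate) auto
      moreover have "generate G (K \<union> S) \<subseteq> H"
        using NK(3) SH NA(2) by (intro generate_subgroup_incl) auto
      ultimately have "H = generate G (K \<union> S)" by (rule equalityI)
      moreover have "H \<subseteq> upper_central H K H (Suc c)"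
        using Hc upper_central_mono[of A K H H "Suc c"] ACK by blast
      ultimately have fgK: "finitely_generated K"
        using finitely_generated_of_nilpotent_quotient[OF fgH K S] by blast
      have "A \<union> C \<subseteq> carrier G" using AC Hcarr by blast
      then have "\<exists>T. finite T \<and> T \<subseteq> C \<and> K = generate G (A \<union> T)"
        using finitely_generated_over[of A C] fgK unfolding K_def by blast
      then obtain T where T: "finite T" "T \<subseteq> C" "K = generate G (A \<union> T)" by blast
      have TE: "T \<subseteq> engel_elements G"
        using T(2) engel_conjugate[OF xE] Hcarr unfolding C_def by auto
      have AK: "normal_in A K" "normal_in B K"
        using normal_in_subgroup[OF A NK(1,3)] normal_in_subgroup[OF B(1) NK(1,3)] ACK B(2) by auto
      have "K \<subseteq> upper_central K A K c"
        unfolding Suc using nilpotency_class_drop[OF A _ xH, of k K] Hc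
        unfolding Suc K_def C_def by blast
      then obtain m where "A \<subseteq> upper_central A B K m"
        using Suc.IH[OF fgK AK B(2) AB T(1) TE T(3)] by blast
      moreover have "upper_central A B K m \<subseteq> upper_central A B (A \<union> C) m"
        using ACK by (rule upper_central_antimono)
      ultimately show ?thesis unfolding C_def by blast
    qed
  qed
  have "\<exists>m. A \<subseteq> upper_central A B (A \<union> (\<Union>x\<in>T. conjugacy_class x H)) m"
    if "finite T" "T \<subseteq> S" for T
    using that
  proof (induction rule: finite_induct)
    case empty
    have "A \<subseteq> upper_central A B (A \<union> (\<Union>x\<in>{}. conjugacy_class x H)) (Suc 0)"
      using AB by auto
    then show ?case by (rule exI)
  next
    case (insert x T)
    let ?Y = "A \<union> (\<Union>x\<in>T. conjugacy_class x H)" and ?Z = "A \<union> conjugacy_class x H"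
    obtain m where m: "A \<subseteq> upper_central A B ?Y m" using insert by auto
    obtain n where n: "A \<subseteq> upper_central A B ?Z n" using single[of x] insert by auto
    have cc: "conjugacy_class y H \<subseteq> H"
      "\<And>z h. z \<in> conjugacy_class y H \<Longrightarrow> h \<in> H \<Longrightarrow> conjugate z h \<in> conjugacy_class y H"
      if "y \<in> insert x T" for y
      using conjugacy_class_closed(1,3)[OF NA(2), of y] that insert.prems SH by blast+
    have "A \<subseteq> upper_central A B (?Y \<union> ?Z) (m * n)"
    proof (rule upper_central_Un[OF A B _ _ _ m n])
      show "?Y \<subseteq> H" "?Z \<subseteq> H" using NA(3) cc(1) by blast+
      fix y h assume y: "y \<in> ?Y" and h: "h \<in> H"
      show "conjugate y h \<in> ?Y"
      proof (cases "y \<in> A")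
        case True
        then show ?thesis using NA(4) h by blast
      next
        case False
        then obtain t where "t \<in> T" "y \<in> conjugacy_class t H" using y by blast
        then show ?thesis using cc(2)[of t y h] h by blast
      qed
    qed
    moreover have "?Y \<union> ?Z = A \<union> (\<Union>x\<in>insert x T. conjugacy_class x H)" by blast
    ultimately show ?case by metis
  qed
  from this[OF S(1) subset_refl] obtain m
    where m: "A \<subseteq> upper_central A B (A \<union> (\<Union>x\<in>S. conjugacy_class x H)) m" by blast
  let ?Z = "A \<union> (\<Union>x\<in>S. conjugacy_class x H)"
  have "upper_central A B ?Z m \<subseteq> upper_central A B (A \<union> S) m"
    using conjugacy_class_closed(2)[OF NA(2)] SH by (intro upper_central_antimono) blast
  moreover have "upper_central A B (A \<union> S) m = upper_central A B H m"
    using upper_central_generate[of A "A \<union> S" B m] A B SH NA(3) Hcarr unfolding H[symmetric] by blast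
  ultimately show ?case using m by blast
qed

section \<open>Extensions by locally soluble groups\<close>

lemma normal_in_derived:
  assumes A: "normal_in A H"
  shows "normal_in (derived G A) H"
  unfolding derived_def
proof (rule normal_in_generate)
  note NA = normal_inD[OF A]
  show "subgroup H G" by (rule NA)
  show "derived_set G A \<subseteq> H" using derived_set_incl[OF NA(3,2)] .
  fix s h assume "s \<in> derived_set G A" and h: "h \<in> H"
  then obtain a b where ab: "a \<in> A" "b \<in> A" "s = a \<otimes> b \<otimes> inv a \<otimes> inv b" by blast
  have "a \<in> carrier G" "b \<in> carrier G" "h \<in> carrier G"
    using ab h subgroup.mem_carrier[OF NA(1)] subgroup.mem_carrier[OF NA(2)] by auto
  then have "conjugate s h =
      conjugate a h \<otimes> conjugate b h \<otimes> inv (conjugate a h) \<otimes> inv (conjugate b h)"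
    unfolding ab(3) by (simp add: group_word_simps)
  then have "conjugate s h \<in> derived_set G A"
    using NA(4)[OF ab(1) h] NA(4)[OF ab(2) h] by blast
  then show "conjugate s h \<in> generate G (derived_set G A)" by (rule generate.incl)
qed

lemma normal_in_generate_Un:
  assumes "normal_in A H" "normal_in B H"
  shows "normal_in (generate G (A \<union> B)) H"
proof (rule normal_in_generate)
  show "subgroup H G" "A \<union> B \<subseteq> H" using assms normal_inD(2,3) by blast+
  fix s h assume "s \<in> A \<union> B" "h \<in> H"
  then have "conjugate s h \<in> A \<union> B"
    using normal_inD(4)[OF assms(1)] normal_inD(4)[OF assms(2)] by blast
  then show "conjugate s h \<in> generate G (A \<union> B)" by (rule generate.incl)
qed

lemma commutator_in_derived:
  assumes A: "subgroup A G" and "a \<in> A" "b \<in> A"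
  shows "commutator G a b \<in> derived G A"
proof -
  have c: "a \<in> carrier G" "b \<in> carrier G" using assms subgroup.mem_carrier by metis+
  have "commutator G a b = inv a \<otimes> inv b \<otimes> inv (inv a) \<otimes> inv (inv b)"
    using c by (simp add: commutator_def)
  moreover have "inv a \<in> A" "inv b \<in> A" using assms subgroup.m_inv_closed by metis+
  ultimately have "commutator G a b \<in> derived_set G A" by blast
  then show ?thesis unfolding derived_def by (rule generate.incl)
qed

text \<open>Gruenberg's descent: the subgroups generated by \<open>P\<close> and a derived term of \<open>N\<close> have abelian
  successive factors, and \<open>K\<close> acts nilpotently on each of them, so every step adds finitely much to
  the class.\<close>
lemma nilpotent_mod_derived_series:
  assumes K: "K = generate G S" and S: "finite S" "S \<subseteq> engel_elements G"
    and N: "normal_in N K" and P: "normal_in P K"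
    and c: "K \<subseteq> upper_central K N K c"
  shows "\<exists>c. K \<subseteq> upper_central K (generate G ((derived G ^^ i) N \<union> P)) K c"
proof -
  define D where "D i = (derived G ^^ i) N" for i
  define A where "A i = generate G (D i \<union> P)" for i
  note NP = normal_inD[OF P]
  have Sc: "S \<subseteq> carrier G" using S(2) by (auto simp: engel_elements_def)
  have fgK: "finitely_generated K" unfolding finitely_generated_def using K S(1) Sc by blast
  have D: "normal_in (D i) K" for i
    by (induction i) (simp_all add: D_def N normal_in_derived)
  have A: "normal_in (A i) K" for i
    unfolding A_def using D P by (rule normal_in_generate_Un)
  have DA: "D i \<union> P \<subseteq> A i" for i
    unfolding A_def by (auto intro: generate.incl)
  have DK: "D i \<union> P \<subseteq> K" for i
    using normal_inD(3)[OF D] NP(3) by blast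
  have D_Suc: "D (Suc i) = derived G (D i)" for i by (simp add: D_def)
  have A_Suc: "A (Suc i) \<subseteq> A i" for i
    using derived_incl[OF subset_refl normal_inD(1)[OF D]] unfolding A_def D_Suc
    by (intro mono_generate) blast
  have "\<exists>c. K \<subseteq> upper_central K (A i) K c"
  proof (induction i)
    case 0
    have "N \<subseteq> A 0" using DA[of 0] by (simp add: D_def)
    then show ?case using c upper_central_mono[of N "A 0" K K c] by blast
  next
    case (Suc i)
    then obtain c where c: "K \<subseteq> upper_central K (A i) K c" by blast
    have "commutator G a b \<in> A (Suc i)" if "a \<in> D i \<union> P" "b \<in> D i \<union> P" for a b
    proof (cases "a \<in> P \<or> b \<in> P")
      case True
      then have "commutator G a b \<in> P"
        using normal_in_commutator_closed[OF P] that DK[of i] by blast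
      then show ?thesis using DA[of "Suc i"] by blast
    next
      case False
      then have "commutator G a b \<in> D (Suc i)"
        unfolding D_Suc using commutator_in_derived[OF normal_inD(1)[OF D[of i]]] that by blast
      then show ?thesis using DA[of "Suc i"] by blast
    qed
    then have comm: "commutator G a b \<in> A (Suc i)" if "a \<in> A i" "b \<in> A i" for a b
      using commutator_generate_generate[OF A DK DK] that unfolding A_def[of i] by blast
    have "K \<subseteq> generate G (A i \<union> S)"
      unfolding K by (intro mono_generate) blast
    moreover have "generate G (A i \<union> S) \<subseteq> K"
      using normal_inD(2,3)[OF A[of i]] K
      by (intro generate_subgroup_incl) (auto intro: generate.incl)
    ultimately have "K = generate G (A i \<union> S)" by (rule equalityI)
    then obtain m where "A i \<subseteq> upper_central (A i) (A (Suc i)) K m"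
      using engel_generated_acts_nilpotently[OF fgK A A A_Suc comm S _ c] by blast
    then have "A i \<subseteq> upper_central K (A (Suc i)) K m"
      using upper_central_mono_total[OF normal_inD(3)[OF A[of i]]] by blast
    then have "K \<subseteq> upper_central K (A (Suc i)) K (c + m)"
      unfolding upper_central_add using c upper_central_mono by blast
    then show ?case by blast
  qed
  then show ?thesis unfolding A_def D_def .
qed

text \<open>Homomorphisms carry derived series to derived series, so the derived series of the image of
  \<open>F\<close> in \<open>N / M\<close> becomes trivial exactly when the one of \<open>F\<close> enters \<open>M\<close>.\<close>
lemma derived_series_into_normal:
  assumes N: "subgroup N G" and M: "M \<lhd> G\<lparr>carrier := N\<rparr>"
    and sol: "locally_solvable (G\<lparr>carrier := N\<rparr> Mod M)"
    and F: "finite F" "F \<subseteq> N"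
  shows "\<exists>d. (derived G ^^ d) (generate G F) \<subseteq> M"
proof -
  let ?N = "G\<lparr>carrier := N\<rparr>"
  let ?Q = "?N Mod M" and ?\<pi> = "\<lambda>a. M #>\<^bsub>?N\<^esub> a"
  interpret M: normal M ?N by (rule M)
  have gN: "group ?N" using subgroup_imp_group[OF N] .
  interpret Q: group ?Q by (rule M.factorgroup_is_group)
  interpret \<pi>: group_hom ?N ?Q ?\<pi>
    using gN Q.is_group M.r_coset_hom_Mod by (simp add: group_hom_def group_hom_axioms_def)
  interpret j: group_hom ?N G id by (rule canonical_inj_is_hom[OF N])
  let ?H = "generate ?N F"
  have H: "?H \<subseteq> carrier ?N" using F(2) by (intro M.generate_incl) simp
  have HG: "?H = generate G F" using generate_consistent[OF F(2) N] .
  have img: "generate ?Q (?\<pi> ` F) = ?\<pi> ` ?H" using \<pi>.generate_img[of F] F(2) by simp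
  have "?\<pi> ` F \<subseteq> carrier ?Q" using F(2) \<pi>.hom_closed by auto
  then have "solvable (?Q\<lparr>carrier := ?\<pi> ` ?H\<rparr>)" and subQ: "subgroup (?\<pi> ` ?H) ?Q"
    using sol F(1) Q.generate_is_subgroup[of "?\<pi> ` F"]
    unfolding locally_solvable_def img[symmetric] by auto
  interpret R: group "?Q\<lparr>carrier := ?\<pi> ` ?H\<rparr>" by (rule Q.subgroup_imp_group[OF subQ])
  interpret k: group_hom "?Q\<lparr>carrier := ?\<pi> ` ?H\<rparr>" ?Q id
    by (rule Q.canonical_inj_is_hom[OF subQ])
  obtain d where d: "(derived (?Q\<lparr>carrier := ?\<pi> ` ?H\<rparr>) ^^ d) (?\<pi> ` ?H) = {\<one>\<^bsub>?Q\<^esub>}"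
    using R.solvable_iff_trivial_derived_seq \<open>solvable (?Q\<lparr>carrier := ?\<pi> ` ?H\<rparr>)\<close> by auto
  then have "(derived ?Q ^^ d) (?\<pi> ` ?H) = {M}"
    using k.exp_of_derived_img[of "?\<pi> ` ?H" d] by (simp add: FactGroup_def)
  then have trivial: "?\<pi> ` ((derived ?N ^^ d) ?H) = {M}"
    using \<pi>.exp_of_derived_img[OF H, of d] by simp
  have "(derived ?N ^^ d) ?H \<subseteq> M"
  proof
    fix a assume a: "a \<in> (derived ?N ^^ d) ?H"
    then have "a \<in> carrier ?N" using M.exp_of_derived_in_carrier[OF H, of d] by (rule rev_subsetD)
    then have "a \<in> ?\<pi> a" by (rule M.rcos_self[OF _ M.subgroup_axioms])
    moreover have "?\<pi> a \<in> {M}" unfolding trivial[symmetric] using a by (rule imageI)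
    ultimately show "a \<in> M" by simp
  qed
  moreover have "(derived ?N ^^ d) ?H = (derived G ^^ d) (generate G F)"
    using j.exp_of_derived_img[OF H, of d] by (simp add: HG)
  ultimately have "(derived G ^^ d) (generate G F) \<subseteq> M" by simp
  then show ?thesis by (rule exI)
qed

text \<open>Local solubility speaks only of finitely generated subgroups of \<open>N / M\<close>. It applies here
  because the intersection of \<open>N\<close> with \<open>K\<close> is finitely generated.\<close>
lemma nilpotent_mod_locally_solvable_factor:
  assumes K: "K = generate G S" and S: "finite S" "S \<subseteq> engel_elements G"
    and N: "N \<lhd> G" and M: "M \<lhd> G" and "M \<subseteq> N"
    and sol: "locally_solvable (G\<lparr>carrier := N\<rparr> Mod M)"
    and c: "K \<subseteq> upper_central K (N \<inter> K) K c"
  shows "\<exists>c. K \<subseteq> upper_central K (M \<inter> K) K c"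
proof -
  have Sc: "S \<subseteq> carrier G" using S(2) by (auto simp: engel_elements_def)
  have subK: "subgroup K G" unfolding K using Sc by (rule generate_is_subgroup)
  have fgK: "finitely_generated K" unfolding finitely_generated_def using K S(1) Sc by blast
  have subN: "subgroup N G" and subM: "subgroup M G" using N M normal_imp_subgroup by auto
  have NK: "normal_in (N \<inter> K) K" and MK: "normal_in (M \<inter> K) K"
    using N M subK subgroup.subset[OF subK] unfolding normal_iff_normal_in
    by (auto intro: normal_in_Int_subgroup)
  have "K \<subseteq> generate G (N \<inter> K \<union> S)" unfolding K by (intro mono_generate) blast
  moreover have "generate G (N \<inter> K \<union> S) \<subseteq> K"
    using subK K by (intro generate_subgroup_incl) (auto intro: generate.incl)
  ultimately have "K = generate G (N \<inter> K \<union> S)" by (rule equalityI)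
  then have "finitely_generated (N \<inter> K)"
    using finitely_generated_of_nilpotent_quotient[OF fgK NK S _ c] by blast
  then obtain F where F: "finite F" "F \<subseteq> carrier G" "N \<inter> K = generate G F"
    unfolding finitely_generated_def by blast
  have "F \<subseteq> N \<inter> K" unfolding F(3) by (auto intro: generate.incl)
  then have "F \<subseteq> N" by blast
  moreover have "M \<lhd> G\<lparr>carrier := N\<rparr>"
    using normal_restrict_supergroup[OF subN M \<open>M \<subseteq> N\<close>] .
  ultimately obtain d where "(derived G ^^ d) (N \<inter> K) \<subseteq> M"
    using derived_series_into_normal[OF subN _ sol F(1)] F(3) by auto
  moreover have "(derived G ^^ d) (N \<inter> K) \<subseteq> K"
    using normal_inD(1)[OF NK] subK
    by (induction d) (auto dest: derived_incl[of _ K])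
  ultimately have "generate G ((derived G ^^ d) (N \<inter> K) \<union> M \<inter> K) \<subseteq> M \<inter> K"
    using normal_inD(1)[OF MK] by (intro generate_subgroup_incl) auto
  then show ?thesis
    using nilpotent_mod_derived_series[OF K S NK MK c, of d] upper_central_mono by blast
qed

section \<open>Ascending series\<close>

lemma ord_succ_le: "\<alpha> < \<gamma> \<Longrightarrow> ord_succ \<alpha> \<le> \<gamma>" for \<alpha> \<gamma> :: "'i::wellorder"
  unfolding ord_succ_def by (rule Least_le)

lemma ord_zero_le: "ord_zero \<le> \<alpha>" for \<alpha> :: "'i::wellorder"
  unfolding ord_zero_def by (rule Least_le) simp

lemma ordinal_cases:
  fixes \<alpha> :: "'i::wellorder"
  obtains "\<alpha> = ord_zero" | "is_limit \<alpha>" | \<delta> where "\<delta> < \<alpha>" "\<alpha> = ord_succ \<delta>"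
  unfolding is_limit_def by blast

lemma ascending_normal_series_mono:
  assumes "ascending_normal_series G \<beta> N" and "\<alpha> \<le> \<gamma>" "\<gamma> \<le> \<beta>"
  shows "N \<alpha> \<subseteq> N \<gamma>"
  using assms(2,3)
proof (induction \<gamma> rule: less_induct)
  case (less \<gamma>)
  show ?case
  proof (cases \<gamma> rule: ordinal_cases)
    case 1
    then show ?thesis using less.prems ord_zero_le[of \<alpha>] by simp
  next
    case 2
    then have "N \<gamma> = (\<Union>\<alpha>\<in>{..<\<gamma>}. N \<alpha>)"
      using assms(1) less.prems unfolding ascending_normal_series_def by blast
    then show ?thesis
      using less.prems(1) by (cases "\<alpha> = \<gamma>") auto
  next
    case (3 \<delta>)
    show ?thesis
    proof (cases "\<alpha> = \<gamma>")
      case False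
      then have "\<alpha> \<le> \<delta>"
        using ord_succ_le[of \<delta> \<alpha>] less.prems(1) 3 by force
      then have "N \<alpha> \<subseteq> N \<delta>" using less.IH[of \<delta>] 3(1) less.prems by auto
      also have "\<dots> \<subseteq> N \<gamma>"
        using assms(1) 3 less.prems(2) unfolding ascending_normal_series_def by auto
      finally show ?thesis .
    qed simp
  qed
qed

text \<open>Finitely many ordinals below \<open>\<mu>\<close> have a common bound below \<open>\<mu>\<close>; \<open>ord_zero\<close> serves as the
  bound when \<open>S\<close> is empty.\<close>
lemma finite_bounded_choice:
  fixes \<mu> :: "'i::wellorder"
  assumes "finite S" "\<mu> \<noteq> ord_zero" and ex: "\<And>s. s \<in> S \<Longrightarrow> \<exists>\<alpha><\<mu>. Q s \<alpha>"
    and mono: "\<And>s \<alpha> \<gamma>. Q s \<alpha> \<Longrightarrow> \<alpha> \<le> \<gamma> \<Longrightarrow> \<gamma> < \<mu> \<Longrightarrow> Q s \<gamma>"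
  shows "\<exists>\<alpha><\<mu>. \<forall>s\<in>S. Q s \<alpha>"
proof -
  obtain f where f: "\<And>s. s \<in> S \<Longrightarrow> f s < \<mu> \<and> Q s (f s)" using ex by metis
  let ?m = "Max (insert ord_zero (f ` S))"
  have "ord_zero < \<mu>" using ord_zero_le[of \<mu>] assms(2) by simp
  then have less: "?m < \<mu>" using assms(1) f by simp
  have "Q s ?m" if s: "s \<in> S" for s
  proof (rule mono[OF _ _ less])
    show "Q s (f s)" using f[OF s] by simp
    show "f s \<le> ?m" using assms(1) s by (intro Max_ge) auto
  qed
  with less show ?thesis by (intro exI[of _ ?m]) simp
qed

text \<open>Membership in an upper central term relative to the finite set \<open>S\<close> is a condition on finitely
  many iterated commutators, each of which lies in the union \<open>N \<mu>\<close> of an ascending chain, hence in a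
  common earlier term.\<close>
lemma nilpotent_mod_limit:
  assumes series: "ascending_normal_series G \<beta> N" and \<mu>: "is_limit \<mu>" "\<mu> \<le> \<beta>"
    and S: "finite S" "S \<subseteq> carrier G" and K: "K = generate G S"
    and c: "K \<subseteq> upper_central K (N \<mu> \<inter> K) K c"
  shows "\<exists>\<alpha><\<mu>. K \<subseteq> upper_central K (N \<alpha> \<inter> K) K c"
proof -
  let ?U = "\<lambda>\<alpha>. upper_central K (N \<alpha> \<inter> K) S"
  have subK: "subgroup K G" unfolding K using S(2) by (rule generate_is_subgroup)
  have SK: "S \<subseteq> K" unfolding K by (auto intro: generate.incl)
  have NK: "normal_in (N \<alpha> \<inter> K) K" if "\<alpha> \<le> \<beta>" for \<alpha>
    using series that subK subgroup.subset[OF subK]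
    unfolding ascending_normal_series_def normal_iff_normal_in
    by (auto intro: normal_in_Int_subgroup)
  have U: "upper_central K (N \<alpha> \<inter> K) K i = ?U \<alpha> i" if "\<alpha> \<le> \<beta>" for \<alpha> i
    using upper_central_generate[of K S "N \<alpha> \<inter> K" i] normal_in_refl[OF subK] NK[OF that] S(2)
    unfolding K[symmetric] by simp
  have mono: "?U \<alpha> i \<subseteq> ?U \<gamma> i" if "\<alpha> \<le> \<gamma>" "\<gamma> < \<mu>" for \<alpha> \<gamma> i
  proof -
    have "\<gamma> \<le> \<beta>" using that(2) \<mu>(2) by (rule order.trans[OF order.strict_implies_order])
    then have "N \<alpha> \<subseteq> N \<gamma>" using ascending_normal_series_mono[OF series that(1)] by simp
    then show ?thesis by (intro upper_central_mono) blast
  qed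
  have \<mu>0: "\<mu> \<noteq> ord_zero" using \<mu>(1) by (simp add: is_limit_def)
  have limit: "\<exists>\<alpha><\<mu>. a \<in> ?U \<alpha> i" if "a \<in> ?U \<mu> i" for a i
    using that
  proof (induction i arbitrary: a)
    case 0
    have "N \<mu> = (\<Union>\<alpha>\<in>{..<\<mu>}. N \<alpha>)"
      using series \<mu> unfolding ascending_normal_series_def by blast
    then show ?case using 0 by auto
  next
    case (Suc i)
    have "\<exists>\<alpha><\<mu>. \<forall>s\<in>S. commutator G a s \<in> ?U \<alpha> i"
    proof (rule finite_bounded_choice[OF S(1) \<mu>0])
      show "\<exists>\<alpha><\<mu>. commutator G a s \<in> ?U \<alpha> i" if "s \<in> S" for s
        using Suc that by simp
      show "commutator G a s \<in> ?U \<gamma> i"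
        if "commutator G a s \<in> ?U \<alpha> i" "\<alpha> \<le> \<gamma>" "\<gamma> < \<mu>" for s \<alpha> \<gamma>
        using mono[OF that(2,3)] that(1) by blast
    qed
    then show ?case using Suc.prems by auto
  qed
  have "\<exists>\<alpha><\<mu>. \<forall>s\<in>S. s \<in> ?U \<alpha> c"
  proof (rule finite_bounded_choice[OF S(1) \<mu>0])
    show "\<exists>\<alpha><\<mu>. s \<in> ?U \<alpha> c" if "s \<in> S" for s
      using limit c SK that U[OF \<mu>(2)] by blast
    show "s \<in> ?U \<gamma> c" if "s \<in> ?U \<alpha> c" "\<alpha> \<le> \<gamma>" "\<gamma> < \<mu>" for s \<alpha> \<gamma>
      using mono[OF that(2,3)] that(1) by blast
  qed
  then obtain \<alpha> where \<alpha>: "\<alpha> < \<mu>" "S \<subseteq> ?U \<alpha> c" by blast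
  have "\<alpha> \<le> \<beta>" using \<alpha>(1) \<mu>(2) by simp
  then have "normal_in (upper_central K (N \<alpha> \<inter> K) K c) K"
    using normal_in_refl[OF subK] NK subK
    by (intro normal_in_upper_central) (auto intro: subgroup_conjugate_closed)
  then have "K \<subseteq> upper_central K (N \<alpha> \<inter> K) K c"
    using \<alpha>(2) U[OF \<open>\<alpha> \<le> \<beta>\<close>] unfolding K
    by (intro generate_subgroup_incl) (auto dest: normal_inD(1))
  then show ?thesis using \<alpha>(1) by blast
qed

text \<open>The descent through the series starts at \<open>\<beta>\<close>, where \<open>K\<close> is trivial modulo \<open>N \<beta>\<close>, and a least
  ordinal reached by it can be neither a limit nor a successor.\<close>
theorem engel_generated_nilpotent:
  assumes series: "ascending_normal_series G \<beta> N"
    and sol: "\<And>\<alpha>. \<alpha> < \<beta> \<Longrightarrow> locally_solvable (series_factor G N \<alpha>)"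
    and S: "finite S" "S \<subseteq> engel_elements G" and K: "K = generate G S"
  shows "\<exists>c. K \<subseteq> upper_central K {\<one>} K c"
proof -
  define Q where "Q \<alpha> \<longleftrightarrow> \<alpha> \<le> \<beta> \<and> (\<exists>c. K \<subseteq> upper_central K (N \<alpha> \<inter> K) K c)" for \<alpha>
  have Sc: "S \<subseteq> carrier G" using S(2) by (auto simp: engel_elements_def)
  have subK: "subgroup K G" unfolding K using Sc by (rule generate_is_subgroup)
  have "N \<beta> \<inter> K = K"
    using series subgroup.subset[OF subK] unfolding ascending_normal_series_def by auto
  then have "K \<subseteq> upper_central K (N \<beta> \<inter> K) K 0" by simp
  then have "Q \<beta>" unfolding Q_def by blast
  define \<alpha> where "\<alpha> = (LEAST \<alpha>. Q \<alpha>)"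
  have "Q \<alpha>" unfolding \<alpha>_def using \<open>Q \<beta>\<close> by (rule LeastI)
  have least: "\<not> Q \<gamma>" if "\<gamma> < \<alpha>" for \<gamma> using that not_less_Least unfolding \<alpha>_def by blast
  obtain c where c: "K \<subseteq> upper_central K (N \<alpha> \<inter> K) K c" and "\<alpha> \<le> \<beta>"
    using \<open>Q \<alpha>\<close> unfolding Q_def by blast
  show ?thesis
  proof (cases \<alpha> rule: ordinal_cases)
    case 1
    then have "N \<alpha> \<inter> K = {\<one>}"
      using series subgroup.one_closed[OF subK] unfolding ascending_normal_series_def by auto
    then show ?thesis using c by auto
  next
    case 2
    then show ?thesis
      using nilpotent_mod_limit[OF series 2 \<open>\<alpha> \<le> \<beta>\<close> S(1) Sc K c] least \<open>\<alpha> \<le> \<beta>\<close>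
      unfolding Q_def by (meson less_imp_le order_trans)
  next
    case (3 \<delta>)
    then have "\<delta> < \<beta>" using \<open>\<alpha> \<le> \<beta>\<close> by simp
    then have "N \<delta> \<lhd> G" "N \<alpha> \<lhd> G" "N \<delta> \<subseteq> N \<alpha>"
      using series \<open>\<alpha> \<le> \<beta>\<close> 3 unfolding ascending_normal_series_def by auto
    moreover have "locally_solvable (G\<lparr>carrier := N \<alpha>\<rparr> Mod N \<delta>)"
      using sol[OF \<open>\<delta> < \<beta>\<close>] 3 unfolding series_factor_def by simp
    ultimately have "Q \<delta>"
      using nilpotent_mod_locally_solvable_factor[OF K S _ _ _ _ c] \<open>\<delta> < \<beta>\<close>
      unfolding Q_def by auto
    then show ?thesis using least 3 by blast
  qed
qed

section \<open>The Hirsch-Plotkin radical\<close>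

lemma commutator_restrict:
  assumes "subgroup H G" "x \<in> H" "y \<in> H"
  shows "commutator (G\<lparr>carrier := H\<rparr>) x y = commutator G x y"
  using assms by (simp add: commutator_def)

lemma lower_central_series_restrict_Suc:
  assumes H: "subgroup H G" and L: "lower_central_series (G\<lparr>carrier := H\<rparr>) n \<subseteq> H"
  shows "lower_central_series (G\<lparr>carrier := H\<rparr>) (Suc n) =
    generate G {commutator G x y | x y. x \<in> lower_central_series (G\<lparr>carrier := H\<rparr>) n \<and> y \<in> H}"
proof -
  let ?H = "G\<lparr>carrier := H\<rparr>"
  have "{commutator ?H x y | x y. x \<in> lower_central_series ?H n \<and> y \<in> carrier ?H} =
      {commutator G x y | x y. x \<in> lower_central_series ?H n \<and> y \<in> H}" (is "?L = ?R")
    using commutator_restrict[OF H] L by (intro Collect_cong) (auto, (metis subsetD)+)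
  moreover have "?R \<subseteq> H" using subgroup_commutator_closed[OF H] L by blast
  ultimately show ?thesis using generate_consistent[OF _ H, of ?R] by simp
qed

lemma lower_central_series_subset:
  assumes H: "subgroup H G"
  shows "lower_central_series (G\<lparr>carrier := H\<rparr>) n \<subseteq> H"
proof (induction n)
  case 0
  then show ?case by simp
next
  case (Suc n)
  show ?case
    unfolding lower_central_series_restrict_Suc[OF H Suc]
    using subgroup_commutator_closed[OF H] Suc by (intro generate_subgroup_incl[OF _ H]) blast
qed

text \<open>The lower central series descends at least as fast as any central series.\<close>
lemma nilpotent_if_upper_central:
  assumes H: "subgroup H G" and n: "H \<subseteq> upper_central H {\<one>} H n"
  shows "nilpotent (G\<lparr>carrier := H\<rparr>)"
proof -
  let ?L = "lower_central_series (G\<lparr>carrier := H\<rparr>)"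
  have one: "normal_in {\<one>} H"
    using H subgroup.mem_carrier[OF H] subgroup.one_closed[OF H] triv_subgroup
    by (auto simp: normal_in_def)
  have U: "normal_in (upper_central H {\<one>} H i) H" for i
    using normal_in_refl[OF H] one normal_inD(3)[OF one] subgroup_conjugate_closed[OF H]
    by (intro normal_in_upper_central) auto
  have "?L i \<subseteq> upper_central H {\<one>} H (n - i)" if "i \<le> n" for i
    using that
  proof (induction i)
    case 0
    then show ?case using n by simp
  next
    case (Suc i)
    have "n - i = Suc (n - Suc i)" using Suc.prems by simp
    then have "?L i \<subseteq> upper_central H {\<one>} H (Suc (n - Suc i))" using Suc by simp
    then show ?case
      unfolding lower_central_series_restrict_Suc[OF H lower_central_series_subset[OF H]]
      by (intro generate_subgroup_incl normal_inD(1)[OF U]) auto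
  qed
  from this[of n] have "?L n \<subseteq> {\<one>}" by simp
  moreover have "\<one> \<in> ?L n"
    using subgroup.one_closed[OF H] generate.one[of "G\<lparr>carrier := H\<rparr>"] by (cases n) auto
  ultimately have "?L n = {\<one>}" by blast
  then show ?thesis unfolding nilpotent_def by auto
qed

text \<open>Finitely many elements of the group generated by the Engel elements are products of finitely
  many of them, hence lie in a nilpotent subgroup.\<close>
lemma engel_generated_locally_nilpotent:
  assumes series: "ascending_normal_series G \<beta> N"
    and sol: "\<And>\<alpha>. \<alpha> < \<beta> \<Longrightarrow> locally_solvable (series_factor G N \<alpha>)"
  shows "locally_nilpotent (G\<lparr>carrier := generate G (engel_elements G)\<rparr>)"
proof -
  let ?E = "generate G (engel_elements G)"
  have Ec: "engel_elements G \<subseteq> carrier G" by (auto simp: engel_elements_def)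
  have subE: "subgroup ?E G" using Ec by (rule generate_is_subgroup)
  have "nilpotent (G\<lparr>carrier := generate G F\<rparr>)" if F: "finite F" "F \<subseteq> ?E" for F
  proof -
    obtain S where S: "finite S" "S \<subseteq> engel_elements G" "F \<subseteq> generate G S"
      using generate_finite_support_set[OF F] by blast
    let ?K = "generate G S" and ?F = "generate G F"
    have subK: "subgroup ?K G" using S(2) Ec by (intro generate_is_subgroup) blast
    have FK: "?F \<subseteq> ?K" using generate_subgroup_incl[OF S(3) subK] .
    have subF: "subgroup ?F G"
      using F(2) subgroup.subset[OF subE] by (intro generate_is_subgroup) blast
    obtain c where "?K \<subseteq> upper_central ?K {\<one>} ?K c"
      using engel_generated_nilpotent[OF series sol S(1,2) refl] by blast
    then have "?F \<subseteq> upper_central ?F ({\<one>} \<inter> ?F) ?F c"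
      using upper_central_restrict[OF subF FK, of "{\<one>}" c] FK by blast
    moreover have "{\<one>} \<inter> ?F = {\<one>}" using generate.one[of G F] by blast
    ultimately show ?thesis using nilpotent_if_upper_central[OF subF] by metis
  qed
  then show ?thesis
    unfolding locally_nilpotent_def by (simp add: generate_consistent[OF _ subE])
qed

lemma normal_engel_generated: "generate G (engel_elements G) \<lhd> G"
  unfolding normal_iff_normal_in
proof (rule normal_in_generate[OF subgroup_self])
  show "engel_elements G \<subseteq> carrier G" by (auto simp: engel_elements_def)
qed (auto intro: generate.incl engel_conjugate)

lemma iterated_commutator_shift:
  "iterated_commutator G (commutator G g x) x n = iterated_commutator G g x (Suc n)"
  by (induction n) auto

text \<open>Normality brings \<open>[g, x]\<close> into \<open>H\<close> for arbitrary \<open>g\<close>; from there on all commutators are taken in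
  the nilpotent group generated by \<open>[g, x]\<close> and \<open>x\<close>.\<close>
lemma normal_locally_nilpotent_engel:
  assumes H: "H \<lhd> G" and nil: "locally_nilpotent (G\<lparr>carrier := H\<rparr>)"
  shows "H \<subseteq> engel_elements G"
proof
  fix x assume x: "x \<in> H"
  have nH: "normal_in H (carrier G)" using H normal_iff_normal_in by blast
  note NH = normal_inD[OF nH]
  have xc: "x \<in> carrier G" using x NH(3) by blast
  have "\<exists>n\<ge>1. iterated_commutator G g x n = \<one>" if g: "g \<in> carrier G" for g
  proof -
    define a where "a = commutator G g x"
    have a: "a \<in> H" unfolding a_def using normal_in_commutator_closed(2)[OF nH x g] .
    define K where "K = generate G {a, x}"
    have subK: "subgroup K G" unfolding K_def using a x NH(3) by (intro generate_is_subgroup) auto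
    have aK: "a \<in> K" and xK: "x \<in> K" unfolding K_def by (auto intro: generate.incl)
    have "nilpotent (G\<lparr>carrier := K\<rparr>)"
      using nil a x generate_consistent[OF _ NH(1), of "{a, x}"]
      unfolding locally_nilpotent_def K_def by (auto dest: spec[of _ "{a, x}"])
    then obtain n where n: "lower_central_series (G\<lparr>carrier := K\<rparr>) n = {\<one>}"
      unfolding nilpotent_def by auto
    have "iterated_commutator G a x i \<in> lower_central_series (G\<lparr>carrier := K\<rparr>) i" for i
    proof (induction i)
      case 0
      then show ?case using aK by simp
    next
      case (Suc i)
      then show ?case
        unfolding lower_central_series_restrict_Suc[OF subK lower_central_series_subset[OF subK]]
        using xK unfolding iterated_commutator.simps by (intro generate.incl) blast
    qed
    from this[of n] have "iterated_commutator G a x n = \<one>"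
      unfolding n by simp
    then have "iterated_commutator G g x (Suc n) = \<one>"
      using iterated_commutator_shift[of g x n] unfolding a_def by simp
    then show ?thesis by (intro exI[of _ "Suc n"]) simp
  qed
  then show "x \<in> engel_elements G" using xc by (simp add: engel_elements_def)
qed

end

theorem proposition2p7:
  fixes G :: "('a, 'b) monoid_scheme"
    and \<beta> :: "'i::wellorder"
    and N :: "'i \<Rightarrow> 'a set"
  assumes "group G"
    and "ascending_normal_series G \<beta> N"
    and "\<And>\<alpha>. \<alpha> < \<beta> \<Longrightarrow> locally_solvable (series_factor G N \<alpha>)"
  shows "engel_elements G = hirsch_plotkin_radical G"
proof -
  interpret group G by (rule assms(1))
  let ?E = "engel_elements G" and ?H = "generate G (engel_elements G)"
  have nil: "locally_nilpotent (G\<lparr>carrier := ?H\<rparr>)"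
    using engel_generated_locally_nilpotent[OF assms(2,3)] .
  have "?H \<subseteq> ?E"
    using normal_locally_nilpotent_engel[OF normal_engel_generated nil] .
  moreover have "?E \<subseteq> ?H" by (auto intro: generate.incl)
  ultimately have "?H = ?E" by (rule equalityI)
  then have E: "?E \<lhd> G" "locally_nilpotent (G\<lparr>carrier := ?E\<rparr>)"
    using normal_engel_generated nil by simp_all
  have "maximal_normal_locally_nilpotent G H \<longleftrightarrow> H = ?E" for H
    unfolding maximal_normal_locally_nilpotent_def
    using E normal_locally_nilpotent_engel by blast
  then have "maximal_normal_locally_nilpotent G = (\<lambda>H. H = ?E)" by blast
  then show ?thesis unfolding hirsch_plotkin_radical_def by simp
qed

end
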